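(* Let $G$ be a finite simple graph and let $f$ be a Morse function on $G$. For $k\ge0$ let $b_k$ be the $k$-th Betti number of $G$ and $c_k$ the number of critical points of $f$ of Morse index $k$, and put $p(t)=\sum_k b_k t^k$ and $c(t)=\sum_k c_k t^k$. Then the strong Morse inequalities hold: there is a polynomial $r(t)=\sum_k r_k t^k$ with coefficients $r_k\ge 0$ such that $$c(t)-p(t)=(1+t)\,r(t).$$
   Context: For a vertex $x$ of a finite simple graph $G=(V,E)$, the unit sphere $S(x)$ is the subgraph generated (induced) by all vertices directly connected to $x$. For $f:V\to\mathbb{R}$, $S^-_f(x)$ is the subgraph generated by the vertices $y\in S(x)$ with $f(y)<f(x)$. Contractible graphs (inductive definition): the one-vertex graph is contractible; a finite simple graph $G=(V,E)$ is contractible if there exists a vertex $v$ such that both $S(v)$ and the graph generated by $V\setminus\{v\}$ are contractible. Evako spheres (inductive definition): the empty graph is the $(-1)$-sphere. For $k\ge0$, a $k$-graph is a finite simple graph for which every unit sphere is a $(k-1)$-sphere. A $k$-sphere is a $k$-graph which becomes contractible after removing some vertex. A function $f:V\to\mathbb{R}$ is a Morse function if it is locally injective ($f(x)\ne f(y)$ whenever $x,y$ are adjacent) and for every vertex $x$ the graph $S^-_f(x)$ is an $m$-sphere for some $m=m_x\ge -1$. Every vertex $x$ is then a critical point, and its Morse index is $m_x+1$ (so the Morse index is $0$ if $S^-_f(x)$ is empty). The Betti number $b_k$ is the dimension of the $k$-th simplicial cohomology group $H^k(G)$ with real coefficients of the Whitney complex of $G$ (whose simplices are the vertex sets of the nonempty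 complete subgraphs of $G$). *)

theory Defs
  imports
    "Graph_Theory.Graph_Theory"
    "Jordan_Normal_Form.VS_Connect"
    "HOL-Algebra.QuotRing"
    "HOL-Computational_Algebra.Polynomial"
begin

text \<open>
  A finite simple graph is a \<^const>\<open>graph\<close> of the theory \<^theory>\<open>Graph_Theory.Digraph\<close>: a finite
  digraph without loops and multiple arcs whose arc relation is symmetric. Thus
  \<open>x \<rightarrow>\<^bsub>G\<^esub> y\<close> means that \<open>x\<close> and \<open>y\<close> are adjacent, and \<open>G \<restriction> W\<close> is the subgraph generated by \<open>W\<close>.
\<close>

definition unit_sphere :: "('a, 'b) pre_digraph \<Rightarrow> 'a \<Rightarrow> ('a, 'b) pre_digraph" where
  "unit_sphere G x = G \<restriction> {y \<in> verts G. x \<rightarrow>\<^bsub>G\<^esub> y}"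

definition stable_sphere ::
    "('a, 'b) pre_digraph \<Rightarrow> ('a \<Rightarrow> real) \<Rightarrow> 'a \<Rightarrow> ('a, 'b) pre_digraph" where
  "stable_sphere G f x = G \<restriction> {y \<in> verts (unit_sphere G x). f y < f x}"

definition remove_vertex :: "('a, 'b) pre_digraph \<Rightarrow> 'a \<Rightarrow> ('a, 'b) pre_digraph" where
  "remove_vertex G v = G \<restriction> (verts G - {v})"

inductive contractible :: "('a, 'b) pre_digraph \<Rightarrow> bool" where
  one_vertex: "graph G \<Longrightarrow> verts G = {v} \<Longrightarrow> contractible G"
| extend: "graph G \<Longrightarrow> v \<in> verts G \<Longrightarrow> contractible (unit_sphere G v) \<Longrightarrow>
    contractible (remove_vertex G v) \<Longrightarrow> contractible G"

inductive evako_graph :: "int \<Rightarrow> ('a, 'b) pre_digraph \<Rightarrow> bool"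
  and evako_sphere :: "int \<Rightarrow> ('a, 'b) pre_digraph \<Rightarrow> bool" where
  empty_sphere: "graph G \<Longrightarrow> verts G = {} \<Longrightarrow> evako_sphere (-1) G"
| k_graph: "0 \<le> k \<Longrightarrow> graph G \<Longrightarrow> \<forall>x\<in>verts G. evako_sphere (k - 1) (unit_sphere G x) \<Longrightarrow>
    evako_graph k G"
| k_sphere: "evako_graph k G \<Longrightarrow> v \<in> verts G \<Longrightarrow> contractible (remove_vertex G v) \<Longrightarrow>
    evako_sphere k G"

definition morse_function :: "('a, 'b) pre_digraph \<Rightarrow> ('a \<Rightarrow> real) \<Rightarrow> bool" where
  "morse_function G f \<longleftrightarrow>
    (\<forall>x\<in>verts G. \<forall>y\<in>verts G. x \<rightarrow>\<^bsub>G\<^esub> y \<longrightarrow> f x \<noteq> f y) \<and>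
    (\<forall>x\<in>verts G. \<exists>m\<ge>-1. evako_sphere m (stable_sphere G f x))"

text \<open>The dimension of an Evako sphere is unique, see \<open>evako_sphere_unique\<close> below.\<close>

definition morse_index :: "('a, 'b) pre_digraph \<Rightarrow> ('a \<Rightarrow> real) \<Rightarrow> 'a \<Rightarrow> int" where
  "morse_index G f x = (THE m. evako_sphere m (stable_sphere G f x)) + 1"

text \<open>For a Morse function every vertex is a critical point.\<close>

definition num_critical :: "('a, 'b) pre_digraph \<Rightarrow> ('a \<Rightarrow> real) \<Rightarrow> nat \<Rightarrow> nat" where
  "num_critical G f k = card {x \<in> verts G. morse_index G f x = int k}"

definition whitney_complex :: "('a, 'b) pre_digraph \<Rightarrow> 'a set set" where
  "whitney_complex G =
    {W. W \<noteq> {} \<and> W \<subseteq> verts G \<and> (\<forall>x\<in>W. \<forall>y\<in>W. x \<noteq> y \<longrightarrow> x \<rightarrow>\<^bsub>G\<^esub> y)}"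

text \<open>
  The real simplicial cochain complex is rendered without a choice of orientations: a \<open>k\<close>-cochain
  is a function on the \<open>k\<close>-simplices with an ordering of their \<open>k + 1\<close> vertices, extended by zero
  to all lists, that changes sign whenever two vertices are interchanged.
\<close>

definition ordered_simplices :: "('a, 'b) pre_digraph \<Rightarrow> nat \<Rightarrow> 'a list set" where
  "ordered_simplices G k =
    {xs. distinct xs \<and> length xs = k + 1 \<and> set xs \<in> whitney_complex G}"

definition alternating :: "('a list \<Rightarrow> real) \<Rightarrow> bool" where
  "alternating c \<longleftrightarrow>
    (\<forall>xs a ys b zs. c (xs @ b # ys @ a # zs) = - c (xs @ a # ys @ b # zs))"

definition cochain_space ::
    "('a, 'b) pre_digraph \<Rightarrow> nat \<Rightarrow> (real, 'a list \<Rightarrow> real) module" where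
  "cochain_space G k =
    \<lparr>carrier = {c. alternating c \<and> (\<forall>xs. xs \<notin> ordered_simplices G k \<longrightarrow> c xs = 0)},
     mult = undefined, one = undefined,
     zero = (\<lambda>xs. 0), add = (\<lambda>c d xs. c xs + d xs), smult = (\<lambda>r c xs. r * c xs)\<rparr>"

definition coboundary ::
    "('a, 'b) pre_digraph \<Rightarrow> nat \<Rightarrow> ('a list \<Rightarrow> real) \<Rightarrow> 'a list \<Rightarrow> real" where
  "coboundary G k c xs =
    (if xs \<in> ordered_simplices G (k + 1)
     then \<Sum>i\<le>k + 1. (- 1) ^ i * c (take i xs @ drop (i + 1) xs) else 0)"

definition cocycles :: "('a, 'b) pre_digraph \<Rightarrow> nat \<Rightarrow> ('a list \<Rightarrow> real) set" where
  "cocycles G k = {c \<in> carrier (cochain_space G k). coboundary G k c = (\<lambda>xs. 0)}"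

fun coboundaries :: "('a, 'b) pre_digraph \<Rightarrow> nat \<Rightarrow> ('a list \<Rightarrow> real) set" where
  "coboundaries G 0 = {\<lambda>xs. 0}"
| "coboundaries G (Suc k) = coboundary G k ` carrier (cochain_space G k)"

text \<open>
  The module structure on the cosets of a submodule \<open>N\<close>, in the style of \<^const>\<open>FactRing\<close>.
  The scalar multiple is a union of cosets because for \<open>r = 0\<close> the elementwise multiple of a
  coset is not a coset.
\<close>

definition quotient_module :: "('r, 'm, 'e) module_scheme \<Rightarrow> 'm set \<Rightarrow> ('r, 'm set) module" where
  "quotient_module M N =
    \<lparr>carrier = a_rcosets\<^bsub>M\<^esub> N, mult = undefined, one = undefined, zero = N, add = set_add M,
     smult = (\<lambda>r X. \<Union>x\<in>X. N +>\<^bsub>M\<^esub> (r \<odot>\<^bsub>M\<^esub> x))\<rparr>"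

definition cohomology ::
    "('a, 'b) pre_digraph \<Rightarrow> nat \<Rightarrow> (real, ('a list \<Rightarrow> real) set) module" where
  "cohomology G k =
    quotient_module (cochain_space G k\<lparr>carrier := cocycles G k\<rparr>) (coboundaries G k)"

definition betti :: "('a, 'b) pre_digraph \<Rightarrow> nat \<Rightarrow> nat" where
  "betti G k = vectorspace.dim class_ring (cohomology G k)"

text \<open>For finite graphs the index sets below are finite, see \<open>coeff_poincare_poly\<close>
  and \<open>coeff_morse_poly\<close>.\<close>

definition poincare_poly :: "('a, 'b) pre_digraph \<Rightarrow> real poly" where
  "poincare_poly G = (\<Sum>k | betti G k \<noteq> 0. monom (real (betti G k)) k)"

definition morse_poly :: "('a, 'b) pre_digraph \<Rightarrow> ('a \<Rightarrow> real) \<Rightarrow> real poly" where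
  "morse_poly G f = (\<Sum>k | num_critical G f k \<noteq> 0. monom (real (num_critical G f k)) k)"

lemma evako_sphere_iff:
  "evako_sphere k G \<longleftrightarrow>
    k = -1 \<and> graph G \<and> verts G = {} \<or>
    evako_graph k G \<and> (\<exists>v\<in>verts G. contractible (remove_vertex G v))"
  by (subst evako_sphere.simps) auto

lemma evako_sphere_dim:
  "evako_graph k G \<Longrightarrow> verts G \<noteq> {} \<Longrightarrow> evako_sphere m G \<Longrightarrow> k = m"
  "evako_sphere k G \<Longrightarrow> evako_sphere m G \<Longrightarrow> k = m"
proof (induction arbitrary: m and m rule: evako_graph_evako_sphere.inducts)
  case (empty_sphere G)
  then show ?case by (auto simp: evako_sphere_iff)
next
  case (k_graph k G)
  then obtain x where x: "x \<in> verts G" by blast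
  from k_graph.prems have "evako_graph m G"
    by (auto simp: evako_sphere_iff)
  then have "evako_sphere (m - 1) (unit_sphere G x)"
    using x by (auto elim: evako_graph.cases)
  with k_graph x have "k - 1 = m - 1" by blast
  then show ?case by simp
next
  case (k_sphere k G v)
  then show ?case by blast
qed

lemma evako_sphere_unique: "evako_sphere k G \<Longrightarrow> evako_sphere m G \<Longrightarrow> k = m"
  by (rule evako_sphere_dim)

lemma morse_index_eq: "evako_sphere m (stable_sphere G f x) \<Longrightarrow> morse_index G f x = m + 1"
  unfolding morse_index_def by (metis evako_sphere_unique the_equality)

lemma finite_num_critical:
  assumes "finite (verts G)"
  shows "finite {k. num_critical G f k \<noteq> 0}"
proof (rule finite_subset)
  show "{k. num_critical G f k \<noteq> 0} \<subseteq> (\<lambda>x. nat (morse_index G f x)) ` verts G"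
  proof
    fix k assume "k \<in> {k. num_critical G f k \<noteq> 0}"
    then have "{x \<in> verts G. morse_index G f x = int k} \<noteq> {}"
      unfolding num_critical_def by (metis (lifting) card.empty mem_Collect_eq)
    then obtain x where "x \<in> verts G" "morse_index G f x = int k" by blast
    then show "k \<in> (\<lambda>x. nat (morse_index G f x)) ` verts G" by force
  qed
qed (use assms in simp)

lemma coeff_sum_monom:
  assumes "finite {k. b k \<noteq> (0::nat)}"
  shows "coeff (\<Sum>k | b k \<noteq> 0. monom (real (b k)) k) n = real (b n)"
  using assms by (simp add: coeff_sum coeff_monom if_distrib[of "\<lambda>f. f _"] sum.delta cong: if_cong)

lemma coeff_morse_poly: "graph G \<Longrightarrow> coeff (morse_poly G f) k = real (num_critical G f k)"
  unfolding morse_poly_def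
  by (intro coeff_sum_monom finite_num_critical)
    (simp add: graph_def digraph_def fin_digraph.finite_verts)

lemma quotient_smult_coset:
  assumes N: "submodule R N M" and r: "r \<in> carrier R" and x: "x \<in> carrier M"
  shows "(\<Union>y\<in>N +>\<^bsub>M\<^esub> x. N +>\<^bsub>M\<^esub> (r \<odot>\<^bsub>M\<^esub> y)) = N +>\<^bsub>M\<^esub> (r \<odot>\<^bsub>M\<^esub> x)"
proof -
  interpret M: module R M using N by (simp add: submodule_def)
  interpret S: submodule R N M by fact
  have *: "N +>\<^bsub>M\<^esub> (n \<oplus>\<^bsub>M\<^esub> y) = N +>\<^bsub>M\<^esub> y" if n: "n \<in> N" and y: "y \<in> carrier M" for n y
  proof -
    have "n \<in> carrier M" using n S.subset by blast
    then have inv: "(\<ominus>\<^bsub>M\<^esub> n) \<in> N"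
      using S.smult_closed[OF _ n, of "\<ominus>\<^bsub>R\<^esub> \<one>\<^bsub>R\<^esub>"] M.smult_minus_1[of n] by simp
    have "\<exists>h'\<in>N. h \<oplus>\<^bsub>M\<^esub> (n \<oplus>\<^bsub>M\<^esub> y) = h' \<oplus>\<^bsub>M\<^esub> y" if h: "h \<in> N" for h
      using n h y S.subset S.m_closed[of h n]
      by (intro bexI[of _ "h \<oplus>\<^bsub>M\<^esub> n"]) (auto simp: M.a_assoc subset_iff)
    moreover have "\<exists>h'\<in>N. h \<oplus>\<^bsub>M\<^esub> y = h' \<oplus>\<^bsub>M\<^esub> (n \<oplus>\<^bsub>M\<^esub> y)" if h: "h \<in> N" for h
    proof (intro bexI)
      have "h \<in> carrier M" "n \<in> carrier M" using n h S.subset by auto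
      then show "h \<oplus>\<^bsub>M\<^esub> y = (h \<oplus>\<^bsub>M\<^esub> (\<ominus>\<^bsub>M\<^esub> n)) \<oplus>\<^bsub>M\<^esub> (n \<oplus>\<^bsub>M\<^esub> y)"
        using y by (simp add: M.a_assoc M.l_neg M.r_neg1)
      show "h \<oplus>\<^bsub>M\<^esub> (\<ominus>\<^bsub>M\<^esub> n) \<in> N" using h inv by simp
    qed
    ultimately show ?thesis by (fastforce simp: a_r_coset_def r_coset_def)
  qed
  have "N +>\<^bsub>M\<^esub> (r \<odot>\<^bsub>M\<^esub> y) = N +>\<^bsub>M\<^esub> (r \<odot>\<^bsub>M\<^esub> x)" if "y \<in> N +>\<^bsub>M\<^esub> x" for y
  proof -
    from that obtain n where n: "n \<in> N" "y = n \<oplus>\<^bsub>M\<^esub> x" by (auto simp: a_r_coset_def r_coset_def)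
    then show ?thesis
      using *[of "r \<odot>\<^bsub>M\<^esub> n" "r \<odot>\<^bsub>M\<^esub> x"] r x S.subset
      by (simp add: M.smult_r_distr subset_iff)
  qed
  moreover have "x \<in> N +>\<^bsub>M\<^esub> x"
    unfolding a_r_coset_def r_coset_def
    using x S.zero_closed by (auto intro!: bexI[of _ "\<zero>\<^bsub>M\<^esub>"])
  ultimately show ?thesis by blast
qed

lemma module_quotient_module:
  assumes N: "submodule R N M"
  shows "module R (quotient_module M N)"
proof -
  interpret M: module R M using N by (simp add: submodule_def)
  interpret S: submodule R N M by fact
  have "subgroup N (add_monoid M)"
  proof (rule M.add.subgroupI)
    show "(\<ominus>\<^bsub>M\<^esub> a) \<in> N" if "a \<in> N" for a
      using S.smult_closed[OF _ that, of "\<ominus>\<^bsub>R\<^esub> \<one>\<^bsub>R\<^esub>"] M.smult_minus_1[of a]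
        subsetD[OF S.subset that] by simp
    show "N \<noteq> {}" using S.zero_closed by blast
  qed (use S.subset in auto)
  then have "additive_subgroup N M" by (rule additive_subgroup.intro)
  then interpret A: abelian_subgroup N M
    by (rule abelian_subgroupI3) (rule M.abelian_group_axioms)
  note smult = quotient_smult_coset[OF N]
  have C: "carrier (quotient_module M N) = (\<lambda>x. N +>\<^bsub>M\<^esub> x) ` carrier M"
    by (auto simp: quotient_module_def A_RCOSETS_def RCOSETS_def a_r_coset_def)
  have zero: "\<zero>\<^bsub>quotient_module M N\<^esub> = N +>\<^bsub>M\<^esub> \<zero>\<^bsub>M\<^esub>"
    using S.subset by (simp add: quotient_module_def M.a_coset_add_zero)
  have add: "(N +>\<^bsub>M\<^esub> x) \<oplus>\<^bsub>quotient_module M N\<^esub> (N +>\<^bsub>M\<^esub> y) = N +>\<^bsub>M\<^esub> (x \<oplus>\<^bsub>M\<^esub> y)"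
    if "x \<in> carrier M" "y \<in> carrier M" for x y
    using that by (simp add: quotient_module_def A.a_rcos_sum)
  have sm: "r \<odot>\<^bsub>quotient_module M N\<^esub> (N +>\<^bsub>M\<^esub> x) = N +>\<^bsub>M\<^esub> (r \<odot>\<^bsub>M\<^esub> x)"
    if "r \<in> carrier R" "x \<in> carrier M" for x r
    using that by (simp add: quotient_module_def smult)
  show ?thesis
  proof (rule module_criteria)
    show "cring R" ..
    let ?Q = "quotient_module M N"
    show "\<forall>v\<in>carrier ?Q. \<exists>w\<in>carrier ?Q. v \<oplus>\<^bsub>?Q\<^esub> w = \<zero>\<^bsub>?Q\<^esub>"
      by (auto simp: C add zero M.r_neg intro!: bexI[of _ "\<ominus>\<^bsub>M\<^esub> x" for x])
    show "\<forall>v w. v \<in> carrier ?Q \<and> w \<in> carrier ?Q \<longrightarrow> v \<oplus>\<^bsub>?Q\<^esub> w = w \<oplus>\<^bsub>?Q\<^esub> v"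
      using M.a_comm by (force simp: C add)
    show "\<forall>v w x. v \<in> carrier ?Q \<and> w \<in> carrier ?Q \<and> x \<in> carrier ?Q \<longrightarrow>
        (v \<oplus>\<^bsub>?Q\<^esub> w) \<oplus>\<^bsub>?Q\<^esub> x = v \<oplus>\<^bsub>?Q\<^esub> (w \<oplus>\<^bsub>?Q\<^esub> x)"
      by (clarsimp simp: C add M.a_assoc)
  qed (auto simp: C add zero sm M.smult_assoc1 M.smult_l_distr M.smult_r_distr)
qed

lemma alternating_adjacent:
  assumes "\<And>xs a b zs. c (xs @ b # a # zs) = - c (xs @ a # b # zs)"
  shows "alternating c"
proof -
  have "c (xs @ b # ys @ a # zs) = - c (xs @ a # ys @ b # zs)" for xs a ys b zs
  proof (induction ys arbitrary: xs)
    case Nil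
    show ?case using assms[of xs b a zs] by simp
  next
    case (Cons y ys)
    have "c (xs @ b # (y # ys) @ a # zs) = - c ((xs @ [y]) @ b # ys @ a # zs)"
      using assms[of xs b y "ys @ a # zs"] by simp
    also have "\<dots> = c ((xs @ [y]) @ a # ys @ b # zs)" using Cons.IH[of "xs @ [y]"] by simp
    also have "\<dots> = - c (xs @ a # (y # ys) @ b # zs)" using assms[of xs y a "ys @ b # zs"] by simp
    finally show ?case .
  qed
  then show ?thesis unfolding alternating_def by blast
qed

lemma alternatingD: "alternating c \<Longrightarrow> c (xs @ b # ys @ a # zs) = - c (xs @ a # ys @ b # zs)"
  unfolding alternating_def by blast

lemma alternating_zero: "alternating (\<lambda>xs. 0)"
  by (simp add: alternating_def)

lemma alternating_add:
  assumes "alternating c" "alternating d"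
  shows "alternating (\<lambda>xs. c xs + d xs)"
  unfolding alternating_def
proof (intro allI)
  fix xs a ys b zs
  show "c (xs @ b # ys @ a # zs) + d (xs @ b # ys @ a # zs) =
      - (c (xs @ a # ys @ b # zs) + d (xs @ a # ys @ b # zs))"
    using alternatingD[OF assms(1), of xs b ys a zs] alternatingD[OF assms(2), of xs b ys a zs]
    by linarith
qed

lemma alternating_smult:
  assumes "alternating c"
  shows "alternating (\<lambda>xs. r * c xs)"
  unfolding alternating_def
proof (intro allI)
  fix xs a ys b zs
  show "r * c (xs @ b # ys @ a # zs) = - (r * c (xs @ a # ys @ b # zs))"
    by (subst alternatingD[OF assms, of xs b ys a zs]) simp
qed

lemma carrier_cochain_space:
  "c \<in> carrier (cochain_space G k) \<longleftrightarrow>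
    alternating c \<and> (\<forall>xs. xs \<notin> ordered_simplices G k \<longrightarrow> c xs = 0)"
  by (simp add: cochain_space_def)

lemma cochain_space_sel [simp]:
  "\<zero>\<^bsub>cochain_space G k\<^esub> = (\<lambda>xs. 0)"
  "c \<oplus>\<^bsub>cochain_space G k\<^esub> d = (\<lambda>xs. c xs + d xs)"
  "r \<odot>\<^bsub>cochain_space G k\<^esub> c = (\<lambda>xs. r * c xs)"
  by (simp_all add: cochain_space_def)

lemma module_cochain_space: "module class_ring (cochain_space G k)"
proof (rule module_criteria)
  show "cring (class_ring :: real ring)"
    using class_field field.axioms(1) domain.axioms(1) by blast
  show "\<forall>v\<in>carrier (cochain_space G k). \<exists>w\<in>carrier (cochain_space G k).
      v \<oplus>\<^bsub>cochain_space G k\<^esub> w = \<zero>\<^bsub>cochain_space G k\<^esub>"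
  proof
    fix v assume "v \<in> carrier (cochain_space G k)"
    then show "\<exists>w\<in>carrier (cochain_space G k).
        v \<oplus>\<^bsub>cochain_space G k\<^esub> w = \<zero>\<^bsub>cochain_space G k\<^esub>"
      using alternating_smult[of v "-1"]
      by (intro bexI[of _ "\<lambda>xs. - v xs"]) (simp_all add: carrier_cochain_space)
  qed
qed (simp_all add: carrier_cochain_space alternating_zero alternating_add alternating_smult
    algebra_simps)

lemma ordered_simplices_swap:
  "xs @ b # a # zs \<in> ordered_simplices G k \<longleftrightarrow> xs @ a # b # zs \<in> ordered_simplices G k"
  by (auto simp: ordered_simplices_def insert_commute)

lemma coboundary_closed:
  assumes c: "c \<in> carrier (cochain_space G k)"
  shows "coboundary G k c \<in> carrier (cochain_space G (k + 1))"
proof -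
  have "alternating c" using c by (simp add: carrier_cochain_space)
  have adj: "c (xs @ b # a # zs) = - c (xs @ a # b # zs)" for xs a b zs
    using alternatingD[OF \<open>alternating c\<close>, of xs b "[]" a zs] by simp
  have "alternating (coboundary G k c)"
  proof (rule alternating_adjacent)
    fix xs zs :: "'a list" and a b
    define L L' t where "L = xs @ a # b # zs" and "L' = xs @ b # a # zs"
      and "t = (\<lambda>i. if i = length xs then Suc (length xs)
                    else if i = Suc (length xs) then length xs else i)"
    have "coboundary G k c L' = - coboundary G k c L" if L: "L \<in> ordered_simplices G (k + 1)"
    proof -
      have len: "length xs < k + 1"
        using L by (auto simp: ordered_simplices_def L_def)
      have swap: "(- 1) ^ i * c (take i L' @ drop (i + 1) L') =
          - ((- 1) ^ t i * c (take (t i) L @ drop (t i + 1) L))" for i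
      proof -
        consider "i < length xs" | "i = length xs" | "i = Suc (length xs)" | "i \<ge> length xs + 2"
          by linarith
        then show ?thesis
        proof cases
          case 1
          then show ?thesis
            using adj[of "take i xs @ drop (i + 1) xs" b a zs] by (simp add: L_def L'_def t_def)
        next
          case 4
          then obtain j where "i = length xs + 2 + j" using le_Suc_ex by blast
          then show ?thesis
            using adj[of xs b a "take j zs @ drop (j + 1) zs"]
            by (simp add: L_def L'_def t_def numeral_3_eq_3)
        qed (simp_all add: L_def L'_def t_def)
      qed
      have "(\<Sum>i\<le>k + 1. (- 1) ^ i * c (take i L' @ drop (i + 1) L')) =
          (\<Sum>i\<le>k + 1. - ((- 1) ^ t i * c (take (t i) L @ drop (t i + 1) L)))"
        by (simp only: swap)
      also have "\<dots> = (\<Sum>i\<le>k + 1. - ((- 1) ^ i * c (take i L @ drop (i + 1) L)))"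
        by (rule sum.reindex_bij_witness[of _ t t]) (use len in \<open>auto simp: t_def\<close>)
      finally have "(\<Sum>i\<le>k + 1. (- 1) ^ i * c (take i L' @ drop (i + 1) L')) =
          - (\<Sum>i\<le>k + 1. (- 1) ^ i * c (take i L @ drop (i + 1) L))"
        by (simp only: sum_negf)
      moreover have "L' \<in> ordered_simplices G (k + 1)"
        using L ordered_simplices_swap[of xs b a zs G "k + 1"] by (simp add: L_def L'_def)
      ultimately show ?thesis using L by (simp only: coboundary_def if_True)
    qed
    then show "coboundary G k c (xs @ b # a # zs) = - coboundary G k c (xs @ a # b # zs)"
      using ordered_simplices_swap[of xs b a zs G "k + 1"]
      by (cases "L \<in> ordered_simplices G (k + 1)") (auto simp: L_def L'_def coboundary_def)
  qed
  then show ?thesis by (simp add: carrier_cochain_space coboundary_def)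
qed

lemma remove_two_nths:
  assumes "j < i" "i < length xs"
  shows "take j (take i xs @ drop (Suc i) xs) @ drop (Suc j) (take i xs @ drop (Suc i) xs) =
    take (i - 1) (take j xs @ drop (Suc j) xs) @ drop (Suc (i - 1)) (take j xs @ drop (Suc j) xs)"
proof -
  from assms(1) obtain d where "i = Suc (j + d)" using less_imp_Suc_add by blast
  with assms show ?thesis
    by (intro nth_equalityI) (auto simp: nth_append min_def add.commute)
qed

lemma ordered_simplices_remove:
  assumes "xs \<in> ordered_simplices G (k + 1)" "i \<le> k + 1"
  shows "take i xs @ drop (i + 1) xs \<in> ordered_simplices G k"
proof -
  have len: "length xs = k + 2" using assms by (simp add: ordered_simplices_def)
  have sub: "set (take i xs @ drop (i + 1) xs) \<subseteq> set xs"
    by (auto dest: in_set_takeD in_set_dropD)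
  moreover have "distinct (take i xs @ drop (i + 1) xs)"
    using assms set_take_disj_set_drop_if_distinct[of xs i "i + 1"]
    by (simp add: ordered_simplices_def)
  moreover have "length (take i xs @ drop (i + 1) xs) = k + 1"
    using assms(2) len by simp
  moreover from this have "set (take i xs @ drop (i + 1) xs) \<noteq> {}"
    by (metis list.size(3) set_empty add_is_0 one_neq_zero)
  ultimately show ?thesis
    using assms(1) unfolding ordered_simplices_def whitney_complex_def mem_Collect_eq by blast
qed

lemma coboundary_coboundary: "coboundary G (k + 1) (coboundary G k c) = (\<lambda>xs. 0)"
proof
  fix xs
  define D where "D = (\<lambda>i (ys :: 'a list). take i ys @ drop (Suc i) ys)"
  define F where "F = (\<lambda>(i, j). (- 1) ^ i * ((- 1) ^ j * c (D j (D i xs))))"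
  show "coboundary G (k + 1) (coboundary G k c) xs = 0"
  proof (cases "xs \<in> ordered_simplices G (k + 2)")
    case True
    then have len: "length xs = k + 3" by (simp add: ordered_simplices_def)
    have "coboundary G (k + 1) (coboundary G k c) xs =
        (\<Sum>i\<le>k + 2. (- 1) ^ i * coboundary G k c (D i xs))"
      using True by (simp add: coboundary_def D_def)
    also have "\<dots> = (\<Sum>i\<le>k + 2. \<Sum>j\<le>k + 1. F (i, j))"
    proof (rule sum.cong)
      fix i assume "i \<in> {..k + 2}"
      then have "D i xs \<in> ordered_simplices G (k + 1)"
        using ordered_simplices_remove[of xs G "k + 1" i] True by (simp add: D_def)
      then show "(- 1) ^ i * coboundary G k c (D i xs) = (\<Sum>j\<le>k + 1. F (i, j))"
        unfolding F_def coboundary_def D_def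
        by (simp only: if_True prod.case sum_distrib_left Suc_eq_plus1)
    qed simp
    also have "\<dots> = sum F ({..k + 2} \<times> {..k + 1})"
      by (simp only: sum.cartesian_product case_prod_unfold prod.collapse)
    also have "{..k + 2} \<times> {..k + 1} =
        {(i, j). j < i \<and> i \<le> k + 2} \<union> {(i, j). i \<le> j \<and> j \<le> k + 1}"
      by auto
    also have "sum F \<dots> = sum F {(i, j). j < i \<and> i \<le> k + 2} + sum F {(i, j). i \<le> j \<and> j \<le> k + 1}"
    proof (rule sum.union_disjoint)
      show "finite {(i, j). j < i \<and> i \<le> k + 2}"
        by (rule finite_subset[of _ "{..k + 2} \<times> {..k + 2}"]) auto
      show "finite {(i, j). i \<le> j \<and> j \<le> k + 1}"
        by (rule finite_subset[of _ "{..k + 2} \<times> {..k + 2}"]) auto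
    qed auto
    also have "sum F {(i, j). j < i \<and> i \<le> k + 2} = (\<Sum>p\<in>{(i, j). i \<le> j \<and> j \<le> k + 1}. - F p)"
    proof (rule sum.reindex_bij_witness[of _ "\<lambda>(i, j). (Suc j, i)" "\<lambda>(i, j). (j, i - 1)"])
      fix p assume "p \<in> {(i, j). j < i \<and> i \<le> k + 2}"
      then obtain i j where p: "p = (i, j)" "j < i" "i \<le> k + 2" by auto
      then have "D j (D i xs) = D (i - 1) (D j xs)"
        using remove_two_nths[of j i xs] len by (simp add: D_def)
      moreover from p obtain i' where "i = Suc i'" using less_imp_Suc_add by blast
      ultimately show "- F (case p of (i, j) \<Rightarrow> (j, i - 1)) = F p"
        using p by (simp add: F_def)
    qed auto
    finally show ?thesis by (simp add: sum_negf)
  qed (simp add: coboundary_def)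
qed

lemma coboundary_zero: "coboundary G k (\<lambda>xs. 0) = (\<lambda>xs. 0)"
  by (simp add: coboundary_def fun_eq_iff)

lemma coboundary_add:
  "coboundary G k (\<lambda>xs. c xs + d xs) = (\<lambda>xs. coboundary G k c xs + coboundary G k d xs)"
proof
  show "coboundary G k (\<lambda>xs. c xs + d xs) xs = coboundary G k c xs + coboundary G k d xs" for xs
    unfolding coboundary_def
    by (cases "xs \<in> ordered_simplices G (k + 1)")
      (simp_all only: if_True if_False distrib_left sum.distrib add_0_left)
qed

lemma coboundary_smult: "coboundary G k (\<lambda>xs. r * c xs) = (\<lambda>xs. r * coboundary G k c xs)"
proof
  show "coboundary G k (\<lambda>xs. r * c xs) xs = r * coboundary G k c xs" for xs
    unfolding coboundary_def
    by (cases "xs \<in> ordered_simplices G (k + 1)")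
      (simp_all only: if_True if_False sum_distrib_left mult.left_commute[of r] mult_zero_right)
qed

lemma submodule_cocycles: "submodule class_ring (cocycles G k) (cochain_space G k)"
proof (rule submodule.intro)
  show "module class_ring (cochain_space G k)" by (rule module_cochain_space)
  interpret C: module class_ring "cochain_space G k" by (rule module_cochain_space)
  show "\<zero>\<^bsub>cochain_space G k\<^esub> \<in> cocycles G k"
    using C.zero_closed by (simp add: cocycles_def coboundary_zero)
  show "v \<oplus>\<^bsub>cochain_space G k\<^esub> w \<in> cocycles G k"
    if "v \<in> cocycles G k" "w \<in> cocycles G k" for v w
    using that C.add.m_closed[of v w] by (simp add: cocycles_def coboundary_add)
  show "r \<odot>\<^bsub>cochain_space G k\<^esub> v \<in> cocycles G k" if "v \<in> cocycles G k" for r v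
    using that C.smult_closed[of r v] by (simp add: cocycles_def coboundary_smult)
qed (auto simp: cocycles_def)

lemma submodule_coboundaries:
  "submodule class_ring (coboundaries G k) (cochain_space G k\<lparr>carrier := cocycles G k\<rparr>)"
proof (rule submodule.intro)
  let ?Z = "cochain_space G k\<lparr>carrier := cocycles G k\<rparr>"
  show "module class_ring ?Z"
    using module.submodule_is_module[OF module_cochain_space submodule_cocycles] .
  interpret C: module class_ring "cochain_space G l" for l by (rule module_cochain_space)
  show "coboundaries G k \<subseteq> carrier ?Z"
  proof (cases k)
    case 0
    then show ?thesis using C.zero_closed[of k] by (simp add: cocycles_def coboundary_zero)
  next
    case (Suc l)
    then show ?thesis
      using coboundary_closed[of _ G l] coboundary_coboundary[of G l] by (auto simp: cocycles_def)
  qed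
  show "v \<oplus>\<^bsub>?Z\<^esub> w \<in> coboundaries G k"
    if vw: "v \<in> coboundaries G k" "w \<in> coboundaries G k" for v w
  proof (cases k)
    case 0
    then show ?thesis using vw by simp
  next
    case (Suc l)
    then obtain a b where ab: "a \<in> carrier (cochain_space G l)" "b \<in> carrier (cochain_space G l)"
      "v = coboundary G l a" "w = coboundary G l b" using vw by auto
    then show ?thesis
      using Suc C.add.m_closed[of a l b]
      by (auto simp: coboundary_add intro!: image_eqI[of _ _ "\<lambda>xs. a xs + b xs"])
  qed
  show "r \<odot>\<^bsub>?Z\<^esub> v \<in> coboundaries G k" if v: "v \<in> coboundaries G k" for r v
  proof (cases k)
    case 0
    then show ?thesis using v by simp
  next
    case (Suc l)
    then obtain a where a: "a \<in> carrier (cochain_space G l)" "v = coboundary G l a"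
      using v by auto
    then show ?thesis
      using Suc C.smult_closed[of r a l]
      by (auto simp: coboundary_smult intro!: image_eqI[of _ _ "\<lambda>xs. r * a xs"])
  qed
  show "\<zero>\<^bsub>?Z\<^esub> \<in> coboundaries G k"
  proof (cases k)
    case 0
    then show ?thesis by simp
  next
    case (Suc l)
    then show ?thesis
      using C.zero_closed[of l]
      by (auto simp: coboundary_zero intro!: image_eqI[of _ _ "\<lambda>xs. 0"])
  qed
qed

lemma vectorspace_cohomology: "vectorspace class_ring (cohomology G k)"
  unfolding vectorspace_def cohomology_def
  by (intro conjI module_quotient_module submodule_coboundaries class_field)

lemma betti_eq_0:
  assumes "finite (verts G)" "card (verts G) \<le> k"
  shows "betti G k = 0"
proof -
  interpret V: vectorspace class_ring "cohomology G k" by (rule vectorspace_cohomology)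
  have "ordered_simplices G k = {}"
  proof -
    have False if "distinct xs" "length xs = k + 1" "set xs \<subseteq> verts G" for xs
      using that assms card_mono[of "verts G" "set xs"] by (simp add: distinct_card)
    then show ?thesis by (auto simp: ordered_simplices_def whitney_complex_def)
  qed
  then have "carrier (cochain_space G k) \<subseteq> {\<lambda>xs. 0}"
    by (auto simp: carrier_cochain_space)
  then have "cocycles G k \<subseteq> {\<lambda>xs. 0}" by (auto simp: cocycles_def)
  then have "carrier (cohomology G k) \<subseteq> {\<zero>\<^bsub>cohomology G k\<^esub>}"
    using V.zero_closed
    by (auto simp: cohomology_def quotient_module_def A_RCOSETS_def RCOSETS_def)
  then have "carrier (cohomology G k) = {\<zero>\<^bsub>cohomology G k\<^esub>}" by auto
  then have "V.gen_set {}" using V.span_def by (auto simp: V.lincomb_def)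
  then show ?thesis
    unfolding betti_def V.dim_def by (intro Least_eq_0) auto
qed

lemma coeff_poincare_poly:
  assumes "graph G"
  shows "coeff (poincare_poly G) k = real (betti G k)"
proof -
  have fin: "finite (verts G)"
    using assms by (simp add: graph_def digraph_def fin_digraph.finite_verts)
  have "k < card (verts G)" if "betti G k \<noteq> 0" for k
    using betti_eq_0[OF fin, of k] that by linarith
  then have "{k. betti G k \<noteq> 0} \<subseteq> {..<card (verts G)}" by blast
  then have "finite {k. betti G k \<noteq> 0}" by (rule finite_subset) simp
  then show ?thesis unfolding poincare_poly_def by (rule coeff_sum_monom)
qed

end

theory Submission
  imports Defs "Jordan_Normal_Form.DL_Rank"
begin

text \<open>
  Adding a vertex \<open>x\<close> to a complex adds the simplices that contain \<open>x\<close>; they consist of \<open>x\<close> and a possibly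
  empty simplex of the link of \<open>x\<close>. So the relative cohomology is the reduced cohomology of the link, shifted
  by one (\<open>family_betti_cone\<close>). If
  the vertices of \<open>G\<close> are added in the order of increasing \<open>f\<close>, the link of \<open>x\<close> at the time of its arrival is
  the stable sphere of \<open>x\<close>. This is an \<open>m\<close>-sphere, whose reduced cohomology is one-dimensional and sits in
  degree \<open>m\<close>; so \<open>x\<close> contributes \<open>t\<close> to the power \<open>m + 1\<close>, its Morse index.

  It remains to see how Poincare polynomials behave under such a decomposition. With \<open>n(t)\<close> counting the
  dimensions of the cochain spaces and \<open>R(t)\<close> the ranks of the coboundaries, rank-nullity gives
  \<open>p(t) = n(t) - (1 + t) R(t)\<close>. If a family of simplices is split into \<open>A\<close> and \<open>B\<close> such that no simplex
  of \<open>B\<close> is a face of a simplex of \<open>A\<close>, then \<open>n\<close> is additive, and \<open>R\<close> is superadditive because the coboundary is block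
  triangular (\<open>rk_Un_ge\<close>). Hence the sum of the polynomials of the parts minus that of the whole is \<open>(1 + t) r(t)\<close>
  with \<open>r\<close> nonnegative (\<open>family_betti_Un\<close>). This relation is transitive and compatible with sums, so induction over
  the vertices yields the strong Morse inequalities (\<open>family_betti_le_num_critical\<close>).

  The same relation computes the cohomology of spheres. A contractible graph is built from two contractible
  graphs, one of them coned off, so its reduced polynomial is bounded by zero; a sphere is a
  contractible graph together with the cone over a sphere of one dimension less, so its reduced polynomial is bounded
  by a single power of \<open>t\<close>. Since Betti numbers are nonnegative, there is equality in both cases
  (\<open>morse_le_at_most_one\<close>, \<open>family_betti_evako_sphere\<close>).
\<close>

section \<open>Dimensions of function spaces\<close>

text \<open>
  This turns the dimension of a cohomology space into a difference of dimensions of two subspaces of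
  one cochain space, so that no quotients are left in the later arguments. It is the rank-nullity
  theorem for the projection, whose kernel is the submodule.
\<close>

lemma dim_quotient_module:
  assumes V: "vectorspace K M" and fd: "vectorspace.fin_dim K M" and N: "submodule K N M"
  shows "vectorspace.dim K (quotient_module M N) + vectorspace.dim K (M\<lparr>carrier := N\<rparr>) =
    vectorspace.dim K M"
proof -
  interpret V: vectorspace K M by fact
  interpret S: submodule K N M by fact
  interpret Q: vectorspace K "quotient_module M N"
    using module_quotient_module[OF N] V.field_axioms by (simp add: vectorspace_def)
  have neg: "(\<ominus>\<^bsub>M\<^esub> a) \<in> N" if "a \<in> N" for a
    using S.smult_closed[OF _ that, of "\<ominus>\<^bsub>K\<^esub> \<one>\<^bsub>K\<^esub>"] V.smult_minus_1[of a]
      subsetD[OF S.subset that] by simp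
  have "subgroup N (add_monoid M)"
  proof (rule V.M.add.subgroupI)
    show "N \<noteq> {}" using S.zero_closed by blast
  qed (use S.subset neg in auto)
  then have "additive_subgroup N M" by (rule additive_subgroup.intro)
  then interpret A: abelian_subgroup N M
    by (rule abelian_subgroupI3) (rule V.abelian_group_axioms)
  interpret T: linear_map K M "quotient_module M N" "\<lambda>x. N +>\<^bsub>M\<^esub> x"
  proof unfold_locales
    have "N +>\<^bsub>M\<^esub> x \<in> a_rcosets\<^bsub>M\<^esub> N" if "x \<in> carrier M" for x
      using that by (rule V.a_rcosetsI[OF S.subset])
    then show "(\<lambda>x. N +>\<^bsub>M\<^esub> x) \<in> module_hom K M (quotient_module M N)"
      using quotient_smult_coset[OF N]
      by (simp add: module_hom_def quotient_module_def A.a_rcos_sum)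
  qed
  have ker: "T.ker = N"
  proof -
    have "N +>\<^bsub>M\<^esub> x = N \<longleftrightarrow> x \<in> N" if "x \<in> carrier M" for x
      using A.a_rcos_self[OF that] A.a_rcos_const[of x] by blast
    moreover have "\<zero>\<^bsub>quotient_module M N\<^esub> = N" by (simp add: quotient_module_def)
    ultimately show ?thesis using S.subset unfolding T.ker_def by auto
  qed
  have im: "T.im = carrier (quotient_module M N)"
    unfolding T.im_def by (auto simp: quotient_module_def A_RCOSETS_def RCOSETS_def a_r_coset_def)
  show ?thesis using T.rank_nullity[OF fd] by (simp add: ker im)
qed

text \<open>
  All cochain spaces are subspaces of one space of real functions. The multiplicative fields of the
  record are \<open>undefined\<close>, as in \<open>cochain_space\<close>, so that restricting the carrier yields literally the
  same record as a cochain space.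
\<close>

definition function_space :: "(real, 'x \<Rightarrow> real) module" where
  "function_space = \<lparr>carrier = UNIV, mult = undefined, one = undefined,
     zero = (\<lambda>x. 0), add = (\<lambda>c d x. c x + d x), smult = (\<lambda>r c x. r * c x)\<rparr>"

definition vdim :: "('x \<Rightarrow> real) set \<Rightarrow> nat" where
  "vdim S = vectorspace.dim class_ring (function_space\<lparr>carrier := S\<rparr>)"

definition fun_subspace :: "('x \<Rightarrow> real) set \<Rightarrow> bool" where
  "fun_subspace S \<longleftrightarrow> (\<lambda>x. 0) \<in> S \<and> (\<forall>c\<in>S. \<forall>d\<in>S. (\<lambda>x. c x + d x) \<in> S) \<and>
    (\<forall>r. \<forall>c\<in>S. (\<lambda>x. r * c x) \<in> S)"

text \<open>
  A common finite support is a convenient sufficient condition for finite dimension: it is inherited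
  by kernels and by images under coboundary maps without choosing bases.
\<close>

definition fin_subspace :: "('x \<Rightarrow> real) set \<Rightarrow> bool" where
  "fin_subspace S \<longleftrightarrow> fun_subspace S \<and> (\<exists>X. finite X \<and> (\<forall>c\<in>S. \<forall>x. x \<notin> X \<longrightarrow> c x = 0))"

definition fun_linear :: "(('x \<Rightarrow> real) \<Rightarrow> 'y \<Rightarrow> real) \<Rightarrow> bool" where
  "fun_linear T \<longleftrightarrow> (\<forall>c d. T (\<lambda>x. c x + d x) = (\<lambda>y. T c y + T d y)) \<and>
    (\<forall>r c. T (\<lambda>x. r * c x) = (\<lambda>y. r * T c y))"

lemma function_space_sel [simp]:
  "carrier function_space = UNIV"
  "\<zero>\<^bsub>function_space\<^esub> = (\<lambda>x. 0)"
  "c \<oplus>\<^bsub>function_space\<^esub> d = (\<lambda>x. c x + d x)"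
  "r \<odot>\<^bsub>function_space\<^esub> c = (\<lambda>x. r * c x)"
  by (simp_all add: function_space_def)

lemma fun_linear_zero: "fun_linear T \<Longrightarrow> T (\<lambda>x. 0) = (\<lambda>y. 0)"
  unfolding fun_linear_def by (drule conjunct2, drule spec[of _ 0], drule spec[of _ "\<lambda>x. 0"]) simp

lemma vectorspace_function_space: "vectorspace class_ring (function_space :: (real, 'x \<Rightarrow> real) module)"
proof (rule vs_criteria)
  show "\<forall>v\<in>carrier function_space. \<exists>w\<in>carrier function_space.
      v \<oplus>\<^bsub>function_space\<^esub> w = \<zero>\<^bsub>function_space :: (real, 'x \<Rightarrow> real) module\<^esub>"
    by (auto intro!: exI[of _ "\<lambda>x. - v x" for v])
qed (simp_all add: class_field algebra_simps)

lemma subspace_function_space: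
  "fun_subspace S \<Longrightarrow> VectorSpace.subspace class_ring S function_space"
  unfolding fun_subspace_def
  by (intro VectorSpace.subspace.intro vectorspace_function_space submodule.intro)
    (auto intro: vectorspace.axioms(1)[OF vectorspace_function_space])

lemma vectorspace_fun_subspace:
  "fun_subspace S \<Longrightarrow> vectorspace class_ring (function_space\<lparr>carrier := S\<rparr>)"
  by (intro vectorspace.subspace_is_vs vectorspace_function_space subspace_function_space)

lemma subspace_fun_subspace:
  assumes "fun_subspace S" "fun_subspace U" "S \<subseteq> U"
  shows "VectorSpace.subspace class_ring S (function_space\<lparr>carrier := U\<rparr>)"
proof (rule VectorSpace.subspace.intro)
  show vs: "vectorspace class_ring (function_space\<lparr>carrier := U\<rparr>)"
    using assms(2) by (rule vectorspace_fun_subspace)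
  show "submodule class_ring S (function_space\<lparr>carrier := U\<rparr>)"
    using assms unfolding fun_subspace_def
    by (intro submodule.intro vectorspace.axioms(1)[OF vs]) auto
qed

text \<open>
  A maximal linearly independent subset of the subspace is a basis of it, and it exists because the
  size of such subsets is bounded by the dimension of the whole space.
\<close>

lemma (in vectorspace) subspace_fin_dim:
  assumes fd: fin_dim and W: "VectorSpace.subspace K W V"
  shows "vectorspace.fin_dim K (vs W)"
proof -
  interpret W: vectorspace K "vs W" using W by (rule subspace_is_vs)
  have sub: "submodule K W V" using W by (rule is_module)
  then have "W \<subseteq> carrier V" by (rule submodule.subset)
  have small: "finite A \<and> card A \<le> dim" if "A \<subseteq> W" "W.lin_indpt A" for A
  proof -
    have "lin_indpt A" using that span_li_not_depend(2)[OF that(1) sub] by simp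
    then show ?thesis using li_le_dim[OF fd, of A] that \<open>W \<subseteq> carrier V\<close> by blast
  qed
  have "\<exists>A. finite A \<and> maximal A (\<lambda>S. S \<subseteq> W \<and> W.lin_indpt S)"
    by (rule maximal_exists[where N = dim and B = "{}"])
      (use small in \<open>auto simp: W.lin_dep_def\<close>)
  then obtain A where A: "finite A" "maximal A (\<lambda>S. S \<subseteq> carrier (vs W) \<and> W.lin_indpt S)" by auto
  then have "W.basis A" by (intro W.max_li_is_basis)
  then show ?thesis using A(1) unfolding W.fin_dim_def W.basis_def by blast
qed

text \<open>
  Finite support implies finite dimension because the indicator functions of the points of the
  support generate.
\<close>

lemma supported_in_span:
  assumes "finite X" "\<forall>x. x \<notin> X \<longrightarrow> c x = 0"
  shows "c \<in> module.span class_ring function_space ((\<lambda>x y. of_bool (y = x)) ` X)"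
  using assms
proof (induction X arbitrary: c)
  case empty
  interpret V: vectorspace class_ring "function_space :: (real, 'a \<Rightarrow> real) module"
    by (rule vectorspace_function_space)
  from empty have "c = (\<lambda>x. 0)" by auto
  then show ?case by (simp add: V.span_empty)
next
  case (insert x X)
  interpret V: vectorspace class_ring "function_space :: (real, 'a \<Rightarrow> real) module"
    by (rule vectorspace_function_space)
  define e where "e = (\<lambda>x y :: 'a. of_bool (y = x) :: real)"
  interpret S: submodule class_ring "V.span (e ` insert x X)" function_space
    by (rule V.span_is_submodule) simp
  have "c(x := 0) \<in> V.span (e ` X)" unfolding e_def by (rule insert.IH) (use insert in auto)
  moreover have "V.span (e ` X) \<subseteq> V.span (e ` insert x X)" by (rule V.span_is_monotone) auto
  moreover have "e x \<in> V.span (e ` insert x X)" by (rule V.span_mem) auto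
  ultimately have "(\<lambda>y. (c(x := 0)) y + c x * e x y) \<in> V.span (e ` insert x X)"
    using S.m_closed[of "c(x := 0)" "\<lambda>y. c x * e x y"] S.smult_closed[of "c x" "e x"] by auto
  moreover have "(\<lambda>y. (c(x := 0)) y + c x * e x y) = c" by (auto simp: e_def)
  ultimately show ?case by (simp only: e_def)
qed

lemma fin_dim_fin_subspace:
  assumes "fin_subspace (S :: ('x \<Rightarrow> real) set)"
  shows "vectorspace.fin_dim class_ring (function_space\<lparr>carrier := S\<rparr>)"
proof -
  interpret V: vectorspace class_ring "function_space :: (real, 'x \<Rightarrow> real) module"
    by (rule vectorspace_function_space)
  obtain X where X: "finite X" "\<And>c x. c \<in> S \<Longrightarrow> x \<notin> X \<Longrightarrow> c x = 0" and S: "fun_subspace S"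
    using assms unfolding fin_subspace_def by blast
  define e where "e = (\<lambda>x y :: 'x. of_bool (y = x) :: real)"
  let ?W = "V.span (e ` X)"
  have W: "VectorSpace.subspace class_ring ?W function_space"
    by (intro V.span_is_subspace) auto
  interpret W: vectorspace class_ring "V.vs ?W" using W by (rule V.subspace_is_vs)
  have inW: "e ` X \<subseteq> ?W" by (rule V.in_own_span) auto
  have "W.span (e ` X) = ?W"
    using V.span_li_not_depend(1)[OF inW V.is_module[OF W]] by simp
  then have fd: "W.fin_dim" unfolding W.fin_dim_def using X(1) inW by auto
  have "S \<subseteq> ?W" using supported_in_span[OF X(1)] X(2) unfolding e_def by blast
  moreover have "fun_subspace ?W"
    using submodule.m_closed[OF V.is_module[OF W]] submodule.smult_closed[OF V.is_module[OF W]]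
      submodule.zero_closed[OF V.is_module[OF W]] by (simp add: fun_subspace_def)
  ultimately have "VectorSpace.subspace class_ring S (V.vs ?W)"
    using S by (intro subspace_fun_subspace)
  from W.subspace_fin_dim[OF fd this] show ?thesis by simp
qed

lemma fun_subspace_image:
  assumes "fun_linear T" "fun_subspace S"
  shows "fun_subspace (T ` S)"
proof -
  have *: "T (\<lambda>x. c x + d x) = (\<lambda>y. T c y + T d y)" "T (\<lambda>x. r * c x) = (\<lambda>y. r * T c y)" for c d r
    using assms(1) by (simp_all add: fun_linear_def)
  show ?thesis
    using assms(2) fun_linear_zero[OF assms(1)] unfolding fun_subspace_def
    by (auto simp flip: * intro!: image_eqI[of "\<lambda>x. 0"])
qed

lemma fin_subspace_kernel:
  assumes S: "fin_subspace S" and T: "fun_linear T"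
  shows "fin_subspace {c \<in> S. T c = (\<lambda>y. 0)}" (is "fin_subspace ?Z")
proof -
  have 1: "T (\<lambda>x. c x + d x) = (\<lambda>y. T c y + T d y)" "T (\<lambda>x. r * c x) = (\<lambda>y. r * T c y)" for c d r
    using T by (simp_all add: fun_linear_def)
  have 2: "fun_subspace S" using S by (simp add: fin_subspace_def)
  have "fun_subspace ?Z"
    unfolding fun_subspace_def
  proof (intro conjI ballI allI)
    show "(\<lambda>x. 0) \<in> ?Z" using 2 fun_linear_zero[OF T] by (simp add: fun_subspace_def)
    show "(\<lambda>x. c x + d x) \<in> ?Z" if "c \<in> ?Z" "d \<in> ?Z" for c d
      using 2 that 1(1)[of c d] by (simp add: fun_subspace_def)
    show "(\<lambda>x. r * c x) \<in> ?Z" if "c \<in> ?Z" for r c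
      using 2 that 1(2)[of r c] by (simp add: fun_subspace_def)
  qed
  then show ?thesis using S unfolding fin_subspace_def by blast
qed

lemma vdim_rank_nullity:
  assumes S: "fin_subspace S" and T: "fun_linear T"
  shows "vdim (T ` S) + vdim {c \<in> S. T c = (\<lambda>y. 0)} = vdim S"
proof -
  interpret V: vectorspace class_ring "function_space\<lparr>carrier := S\<rparr>"
    using S by (intro vectorspace_fun_subspace) (simp add: fin_subspace_def)
  interpret W: vectorspace class_ring "function_space :: (real, 'b \<Rightarrow> real) module"
    by (rule vectorspace_function_space)
  interpret T: linear_map class_ring "function_space\<lparr>carrier := S\<rparr>"
      "function_space :: (real, 'b \<Rightarrow> real) module" T
    using T by unfold_locales (simp add: module_hom_def fun_linear_def)
  show ?thesis using T.rank_nullity[OF fin_dim_fin_subspace[OF S]]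
    by (simp add: vdim_def T.im_def T.ker_def)
qed

lemma vdim_mono:
  assumes S: "fun_subspace S" and U: "fin_subspace U" and le: "S \<subseteq> U"
  shows "vdim S \<le> vdim U"
proof -
  have "fin_subspace S" using assms by (auto simp: fin_subspace_def)
  from fin_dim_fin_subspace[OF this] show ?thesis
    using vectorspace.subspace_dim[OF vectorspace_fun_subspace subspace_fun_subspace[OF S _ le]
      fin_dim_fin_subspace[OF U]] U unfolding vdim_def by (simp add: fin_subspace_def)
qed

lemma vdim_zero: "vdim {\<lambda>x :: 'x. 0} = 0"
proof -
  have S: "fun_subspace {\<lambda>x :: 'x. 0}" by (simp add: fun_subspace_def)
  then interpret V: vectorspace class_ring "function_space\<lparr>carrier := {\<lambda>x :: 'x. 0}\<rparr>"
    by (rule vectorspace_fun_subspace)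
  have "V.gen_set {}" by (simp add: V.span_empty)
  then show ?thesis unfolding vdim_def V.dim_def by (intro Least_eq_0) auto
qed

lemma vdim_image_inj:
  assumes "fin_subspace S" "fun_linear T" "\<And>c. c \<in> S \<Longrightarrow> T c = (\<lambda>y. 0) \<Longrightarrow> c = (\<lambda>x. 0)"
  shows "vdim (T ` S) = vdim S"
proof -
  have "{c \<in> S. T c = (\<lambda>y. 0)} = {\<lambda>x. 0}"
    using assms fun_linear_zero[OF assms(2)] by (auto simp: fin_subspace_def fun_subspace_def)
  then show ?thesis using vdim_rank_nullity[OF assms(1,2)] by (simp add: vdim_zero)
qed

text \<open>
  In the augmented complex of a graph this is the space of cochains on the empty simplex, where the
  cohomology of the empty graph, the \<open>(-1)\<close>-sphere, is located.
\<close>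

lemma vdim_supported_singleton: "vdim {c :: 'x \<Rightarrow> real. \<forall>x. x \<noteq> a \<longrightarrow> c x = 0} = 1" (is "vdim ?S = 1")
proof -
  have S: "fun_subspace ?S" by (simp add: fun_subspace_def)
  let ?V = "function_space\<lparr>carrier := ?S\<rparr>"
  interpret V: vectorspace class_ring ?V using S by (rule vectorspace_fun_subspace)
  let ?e = "\<lambda>x. of_bool (x = a) :: real"
  interpret E: submodule class_ring "V.span {?e}" ?V by (rule V.span_is_submodule) simp
  have "V.dim = 1"
  proof (rule V.dim1I)
    show "?e \<in> carrier ?V" by simp
    show "?e \<noteq> \<zero>\<^bsub>?V\<^esub>" by (auto simp: fun_eq_iff)
    have "?e \<in> V.span {?e}" by (rule V.span_mem) auto
    then have mult: "(\<lambda>x. r * ?e x) \<in> V.span {?e}" for r using E.smult_closed[of r ?e] by simp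
    have "c \<in> V.span {?e}" if c: "c \<in> ?S" for c
    proof -
      have "(\<lambda>x. c a * ?e x) = c" using c by auto
      then show ?thesis using mult[of "c a"] by simp
    qed
    then show "V.gen_set {?e}" using E.subset by auto
  qed
  then show ?thesis by (simp add: vdim_def)
qed

section \<open>Alternating cochains of a family of finite sets\<close>

text \<open>
  Simplicial complexes are not enough: removing a vertex splits a complex into a subcomplex and the
  set of simplices that contain the vertex, and the latter is not closed under subsets. Cochains are
  therefore defined for an arbitrary family \<open>F\<close> of simplices. The degree \<open>k\<close> is the number of vertices,
  which is the dimension plus one, so that the empty simplex, if it belongs to \<open>F\<close>, sits in degree 0 and
  augmented complexes need no separate treatment.
\<close>

definition alt_cochains :: "'a set set \<Rightarrow> nat \<Rightarrow> ('a list \<Rightarrow> real) set" where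
  "alt_cochains F k =
    {c. alternating c \<and> (\<forall>xs. c xs \<noteq> 0 \<longrightarrow> distinct xs \<and> length xs = k \<and> set xs \<in> F)}"

text \<open>
  Faces that do not belong to \<open>F\<close> contribute nothing to the sum when \<open>c\<close> is a cochain of \<open>F\<close>. If \<open>F\<close> is the
  difference of a complex and a subcomplex, this is the coboundary of the relative cochain complex.
\<close>

definition delta :: "'a set set \<Rightarrow> ('a list \<Rightarrow> real) \<Rightarrow> 'a list \<Rightarrow> real" where
  "delta F c xs =
    (if distinct xs \<and> set xs \<in> F
     then \<Sum>i<length xs. (- 1) ^ i * c (take i xs @ drop (Suc i) xs) else 0)"

text \<open>
  For a subcomplex this is the surjection in the short exact cochain sequence of the pair.
\<close>

definition restr :: "'a set set \<Rightarrow> ('a list \<Rightarrow> real) \<Rightarrow> 'a list \<Rightarrow> real" where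
  "restr F c xs = (if set xs \<in> F then c xs else 0)"

lemma alt_cochainsD:
  assumes "c \<in> alt_cochains F k"
  shows "alternating c" "c xs \<noteq> 0 \<Longrightarrow> distinct xs" "c xs \<noteq> 0 \<Longrightarrow> length xs = k"
    "c xs \<noteq> 0 \<Longrightarrow> set xs \<in> F"
  using assms by (auto simp: alt_cochains_def)

lemma alt_cochains_mono: "F \<subseteq> F' \<Longrightarrow> alt_cochains F k \<subseteq> alt_cochains F' k"
  by (auto simp: alt_cochains_def)

lemma restr_alt_cochains: "c \<in> alt_cochains F k \<Longrightarrow> restr F' c \<in> alt_cochains (F \<inter> F') k"
proof -
  assume c: "c \<in> alt_cochains F k"
  have "alternating (restr F' c)"
    unfolding alternating_def restr_def
  proof (intro allI)
    fix xs ys zs :: "'a list" and a b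
    have "set (xs @ b # ys @ a # zs) = set (xs @ a # ys @ b # zs)" by auto
    then show "(if set (xs @ b # ys @ a # zs) \<in> F' then c (xs @ b # ys @ a # zs) else 0) =
      - (if set (xs @ a # ys @ b # zs) \<in> F' then c (xs @ a # ys @ b # zs) else 0)"
      using alternatingD[OF alt_cochainsD(1)[OF c], of xs b ys a zs] by simp
  qed
  then show ?thesis using c by (auto simp: alt_cochains_def restr_def)
qed

lemma fun_linear_restr: "fun_linear (restr F)"
  by (auto simp: fun_linear_def restr_def)

lemma fun_linear_delta: "fun_linear (delta F)"
  unfolding fun_linear_def
proof (intro conjI allI ext)
  show "delta F (\<lambda>xs. c xs + d xs) xs = delta F c xs + delta F d xs" for c d xs
    by (simp add: delta_def distrib_left sum.distrib)
  show "delta F (\<lambda>xs. r * c xs) xs = r * delta F c xs" for r c xs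
    by (simp add: delta_def sum_distrib_left mult.left_commute[of r])
qed

lemma fin_subspace_alt_cochains:
  assumes "finite (\<Union>F)"
  shows "fin_subspace (alt_cochains F k)"
  unfolding fin_subspace_def
proof (intro conjI exI)
  have "alternating (\<lambda>x. c x + d x)" if "alternating c" "alternating d"
    for c d :: "'a list \<Rightarrow> real"
    using that by (rule alternating_add)
  then show "fun_subspace (alt_cochains F k)"
    by (auto simp: fun_subspace_def alt_cochains_def alternating_zero alternating_smult)
      (metis add_0)+
  show "finite {xs. set xs \<subseteq> \<Union>F \<and> length xs = k}"
    using assms by (rule finite_lists_length_eq)
  show "\<forall>c\<in>alt_cochains F k. \<forall>xs. xs \<notin> {xs. set xs \<subseteq> \<Union>F \<and> length xs = k} \<longrightarrow> c xs = 0"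
    by (auto simp: alt_cochains_def)
qed

lemma fin_subspace_image_alt_cochains:
  assumes "finite (\<Union>F)" "fun_linear T" "T ` alt_cochains F k \<subseteq> alt_cochains F' l" "finite (\<Union>F')"
  shows "fin_subspace (T ` alt_cochains F k)"
proof -
  have "fun_subspace (T ` alt_cochains F k)"
    using fun_subspace_image[OF assms(2)] fin_subspace_alt_cochains[OF assms(1)]
    by (simp add: fin_subspace_def)
  moreover obtain X where "finite X" "\<forall>c\<in>alt_cochains F' l. \<forall>x. x \<notin> X \<longrightarrow> c x = 0"
    using fin_subspace_alt_cochains[OF assms(4), of l] by (auto simp: fin_subspace_def)
  ultimately show ?thesis using assms(3) unfolding fin_subspace_def by blast
qed

text \<open>
  On the complete graph every distinct list is a simplex. The coboundary \<open>delta F\<close> of any family is its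
  coboundary followed by a restriction, so the closure of alternating cochains under coboundaries and
  the relation \<open>d d = 0\<close> for families follow from those for graphs.
\<close>

definition complete_graph :: "('a, 'a \<times> 'a) pre_digraph" where
  "complete_graph = \<lparr>verts = UNIV, arcs = UNIV, tail = fst, head = snd\<rparr>"

lemma ordered_simplices_complete_graph:
  "ordered_simplices complete_graph k = {xs :: 'a list. distinct xs \<and> length xs = Suc k}"
proof -
  have "x \<rightarrow>\<^bsub>complete_graph\<^esub> y" for x y :: 'a
    by (auto simp: complete_graph_def arcs_ends_def arc_to_ends_def)
  then show ?thesis
    by (auto simp: ordered_simplices_def whitney_complex_def complete_graph_def)
qed

lemma carrier_cochain_complete_graph:
  "carrier (cochain_space complete_graph k) = (alt_cochains UNIV (Suc k) :: ('a list \<Rightarrow> real) set)"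
  by (auto simp: carrier_cochain_space ordered_simplices_complete_graph alt_cochains_def)

lemma delta_support:
  assumes "c \<in> alt_cochains F' k" "delta F c xs \<noteq> 0"
  shows "distinct xs" "length xs = Suc k" "set xs \<in> F"
proof -
  show "distinct xs" "set xs \<in> F" using assms(2) by (auto simp: delta_def split: if_splits)
  then have "(\<Sum>i<length xs. (- 1) ^ i * c (take i xs @ drop (Suc i) xs)) \<noteq> 0"
    using assms(2) by (simp add: delta_def)
  then obtain i where "i \<in> {..<length xs}" "(- 1) ^ i * c (take i xs @ drop (Suc i) xs) \<noteq> 0"
    by (rule sum.not_neutral_contains_not_neutral)
  then have i: "i < length xs" "c (take i xs @ drop (Suc i) xs) \<noteq> 0" by auto
  from alt_cochainsD(3)[OF assms(1) i(2)] i(1) show "length xs = Suc k" by auto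
qed

lemma coboundary_complete_graph:
  assumes c: "c \<in> alt_cochains UNIV (Suc k)"
  shows "coboundary complete_graph k c = delta UNIV c"
proof
  fix xs :: "'a list"
  show "coboundary complete_graph k c xs = delta UNIV c xs"
  proof (cases "distinct xs \<and> length xs = k + 2")
    case True
    then show ?thesis
      by (simp add: coboundary_def delta_def ordered_simplices_complete_graph lessThan_Suc_atMost)
  next
    case False
    then show ?thesis
      using delta_support[OF c, of UNIV xs]
      by (auto simp: coboundary_def ordered_simplices_complete_graph)
  qed
qed

lemma restr_delta_UNIV: "restr F (delta UNIV c) = delta F c"
  by (auto simp: restr_def delta_def)

text \<open>
  Lists of length at most one have no two entries to interchange, which settles the degree of the
  empty simplex, where the complete graph gives no information.
\<close>

lemma alt_cochainsI_short:
  assumes "\<And>xs. c xs \<noteq> 0 \<Longrightarrow> length xs = k \<and> set xs \<in> F" "k \<le> 1"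
  shows "c \<in> alt_cochains F k"
proof -
  have z: "c xs = 0" if "length xs \<ge> 2" for xs using assms that by fastforce
  have "distinct xs" if "c xs \<noteq> 0" for xs
    using assms(1)[OF that] assms(2) by (cases xs) auto
  then show ?thesis using assms(1) by (auto simp: alt_cochains_def alternating_def z)
qed

lemma delta_closed:
  assumes c: "c \<in> alt_cochains UNIV k"
  shows "delta F c \<in> alt_cochains F (Suc k)"
proof -
  have "delta UNIV c \<in> alt_cochains UNIV (Suc k)"
  proof (cases k)
    case 0
    show ?thesis by (rule alt_cochainsI_short) (use delta_support[OF c] 0 in auto)
  next
    case (Suc j)
    then show ?thesis
      using coboundary_closed[of c complete_graph j] c
      by (simp add: carrier_cochain_complete_graph coboundary_complete_graph)
  qed
  from restr_alt_cochains[OF this, of F] show ?thesis by (simp add: restr_delta_UNIV)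
qed

lemma delta_delta_UNIV:
  assumes c: "c \<in> alt_cochains UNIV k"
  shows "delta UNIV (delta UNIV c) = (\<lambda>xs. 0)"
proof (cases k)
  case 0
  have "delta UNIV (delta UNIV c) xs = 0" for xs
  proof (rule ccontr)
    assume *: "delta UNIV (delta UNIV c) xs \<noteq> 0"
    then have "length xs = 2" using delta_support(2)[OF delta_closed[OF c]] 0 by simp
    then obtain u v where "xs = [u, v]" by (auto simp: numeral_2_eq_2 length_Suc_conv)
    moreover have "delta UNIV (delta UNIV c) [u, v] = 0"
      by (cases "u = v") (simp_all add: delta_def lessThan_Suc)
    ultimately show False using * by simp
  qed
  then show ?thesis by auto
next
  case (Suc j)
  then show ?thesis
    using coboundary_coboundary[of complete_graph j c] c delta_closed[OF c, of UNIV]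
    by (simp add: coboundary_complete_graph)
qed

lemma take_drop_subset: "set (take i xs @ drop (Suc i) xs) \<subseteq> set xs"
  by (auto dest: in_set_takeD in_set_dropD)

text \<open>
  Closure under subsets makes the intermediate restriction to \<open>F\<close> invisible: all faces of a simplex of
  \<open>F\<close> are in \<open>F\<close>.
\<close>

lemma delta_delta:
  assumes F: "\<And>s t. s \<in> F \<Longrightarrow> t \<subseteq> s \<Longrightarrow> t \<in> F" and c: "c \<in> alt_cochains UNIV k"
  shows "delta F (delta F c) = (\<lambda>xs. 0)"
proof -
  have "delta F (restr F e) = delta F e" for e
  proof
    fix xs
    have "restr F e (take i xs @ drop (Suc i) xs) = e (take i xs @ drop (Suc i) xs)"
      if "set xs \<in> F" for i
      using F[OF that take_drop_subset] by (simp only: restr_def if_True)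
    then show "delta F (restr F e) xs = delta F e xs" by (simp add: delta_def)
  qed
  from this[of "delta UNIV c"] have "delta F (delta F c) = delta F (delta UNIV c)"
    by (simp only: restr_delta_UNIV)
  also have "\<dots> = restr F (delta UNIV (delta UNIV c))" by (simp only: restr_delta_UNIV)
  finally show ?thesis using delta_delta_UNIV[OF c] by (simp add: restr_def fun_eq_iff)
qed

section \<open>Betti numbers of families and the Morse relation\<close>

definition rk :: "'a set set \<Rightarrow> nat \<Rightarrow> nat" where
  "rk F k = vdim (delta F ` alt_cochains F k)"

text \<open>
  On coefficient sequences this is multiplication of the polynomial by \<open>t\<close>.
\<close>

definition shift :: "(nat \<Rightarrow> real) \<Rightarrow> nat \<Rightarrow> real" where
  "shift r k = (case k of 0 \<Rightarrow> 0 | Suc j \<Rightarrow> r j)"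

text \<open>
  When the coboundary squares to zero this is the dimension of the cohomology in degree \<open>k\<close>. As an
  expression in ranks it makes sense for every family, and the comparisons below need only
  ranks.
\<close>

definition family_betti :: "'a set set \<Rightarrow> nat \<Rightarrow> real" where
  "family_betti F k = real (vdim (alt_cochains F k)) - real (rk F k) - shift (\<lambda>j. real (rk F j)) k"

text \<open>
  For sequences read as polynomials, \<open>b \<preceq> c\<close> says \<open>c(t) - b(t) = (1 + t) r(t)\<close> with nonnegative
  coefficients of \<open>r\<close>, which is the form of the strong Morse inequalities.
\<close>

definition morse_le :: "(nat \<Rightarrow> real) \<Rightarrow> (nat \<Rightarrow> real) \<Rightarrow> bool" (infix "\<preceq>" 50) where
  "b \<preceq> c \<longleftrightarrow> (\<exists>r. (\<forall>k. 0 \<le> r k) \<and> (\<forall>k. c k - b k = r k + shift r k))"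

lemma delta_subset: "delta F ` alt_cochains F k \<subseteq> alt_cochains F (Suc k)"
  using delta_closed[of _ k F] alt_cochains_mono[of F UNIV k] by blast

lemma fin_subspace_delta: "finite (\<Union>F) \<Longrightarrow> fin_subspace (delta F ` alt_cochains F k)"
  by (rule fin_subspace_image_alt_cochains[OF _ fun_linear_delta delta_subset])

lemma restr_image: "restr A ` alt_cochains (A \<union> B) k = alt_cochains A k"
proof
  show "restr A ` alt_cochains (A \<union> B) k \<subseteq> alt_cochains A k"
    using restr_alt_cochains[of _ "A \<union> B" k A] by (auto simp: Int_absorb1)
  have "restr A c = c" if "c \<in> alt_cochains A k" for c
  proof
    show "restr A c xs = c xs" for xs using alt_cochainsD(4)[OF that, of xs] by (auto simp: restr_def)
  qed
  then show "alt_cochains A k \<subseteq> restr A ` alt_cochains (A \<union> B) k"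
    using alt_cochains_mono[of A "A \<union> B" k] by force
qed

lemma restr_disjoint:
  assumes c: "c \<in> alt_cochains B k" and disj: "A \<inter> B = {}"
  shows "restr A c = (\<lambda>xs. 0)"
proof
  show "restr A c xs = 0" for xs using alt_cochainsD(4)[OF c, of xs] disj by (auto simp: restr_def)
qed

lemma vdim_alt_cochains_Un:
  assumes fin: "finite (\<Union>A)" "finite (\<Union>B)" and disj: "A \<inter> B = {}"
  shows "vdim (alt_cochains (A \<union> B) k) = vdim (alt_cochains A k) + vdim (alt_cochains B k)"
proof -
  have "{c \<in> alt_cochains (A \<union> B) k. restr A c = (\<lambda>xs. 0)} = alt_cochains B k"
  proof (intro subset_antisym subsetI)
    show "c \<in> alt_cochains B k"
      if "c \<in> {c \<in> alt_cochains (A \<union> B) k. restr A c = (\<lambda>xs. 0)}" for c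
    proof -
      have "c xs = 0" if "set xs \<in> A" for xs
        using \<open>c \<in> _\<close> that by (auto simp: restr_def dest: fun_cong[of _ _ xs])
      then show ?thesis using that by (auto simp: alt_cochains_def)
    qed
    show "c \<in> {c \<in> alt_cochains (A \<union> B) k. restr A c = (\<lambda>xs. 0)}"
      if "c \<in> alt_cochains B k" for c
      using that restr_disjoint[OF that disj] alt_cochains_mono[of B "A \<union> B" k] by auto
  qed
  moreover have "vdim (restr A ` alt_cochains (A \<union> B) k) +
      vdim {c \<in> alt_cochains (A \<union> B) k. restr A c = (\<lambda>xs. 0)} = vdim (alt_cochains (A \<union> B) k)"
    by (rule vdim_rank_nullity[OF fin_subspace_alt_cochains fun_linear_restr]) (use fin in simp)
  ultimately show ?thesis by (simp add: restr_image)
qed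

text \<open>
  Since no simplex of \<open>B\<close> is a face of a simplex of \<open>A\<close>, the coboundary of \<open>A \<union> B\<close> is block triangular with
  diagonal blocks the coboundaries of \<open>A\<close> and \<open>B\<close>, and such a matrix has at least the sum of the ranks of
  the diagonal blocks. In terms of maps: the image of \<open>delta (A \<union> B)\<close> is mapped by restriction onto the image
  of \<open>delta A\<close>, and the kernel of this restriction contains the image of \<open>delta B\<close>.
\<close>

lemma rk_Un_ge:
  assumes fin: "finite (\<Union>A)" "finite (\<Union>B)" and disj: "A \<inter> B = {}"
    and up: "\<And>a b. a \<in> A \<Longrightarrow> b \<in> B \<Longrightarrow> \<not> b \<subseteq> a"
  shows "rk A k + rk B k \<le> rk (A \<union> B) k"
proof -
  let ?F = "A \<union> B" and ?I = "delta (A \<union> B) ` alt_cochains (A \<union> B) k"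
  have I: "fin_subspace ?I" using fin by (intro fin_subspace_delta) simp
  have comm: "restr A (delta ?F c) = delta A (restr A c)" if c: "c \<in> alt_cochains ?F k" for c
  proof
    fix xs
    have "restr A c (take i xs @ drop (Suc i) xs) = c (take i xs @ drop (Suc i) xs)" (is "_ = c ?ys")
      if "set xs \<in> A" for i
    proof (cases "c ?ys = 0")
      case False
      then have "set ?ys \<in> ?F" by (rule alt_cochainsD(4)[OF c])
      then have "set ?ys \<in> A" using up[OF that] take_drop_subset[of i xs] by blast
      then show ?thesis by (simp only: restr_def if_True)
    qed (simp add: restr_def)
    then show "restr A (delta ?F c) xs = delta A (restr A c) xs"
      by (simp add: restr_def[of A "delta ?F c"] delta_def)
  qed
  have "restr A ` ?I = delta A ` restr A ` alt_cochains ?F k"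
    unfolding image_image using comm by (intro image_cong) auto
  then have image: "restr A ` ?I = delta A ` alt_cochains A k" by (simp add: restr_image)
  have "delta B ` alt_cochains B k \<subseteq> {y \<in> ?I. restr A y = (\<lambda>xs. 0)}"
  proof
    fix y assume "y \<in> delta B ` alt_cochains B k"
    then obtain c where c: "c \<in> alt_cochains B k" and y: "y = delta B c" by blast
    have cF: "c \<in> alt_cochains ?F k" using c alt_cochains_mono[of B ?F k] by blast
    have A: "restr A (delta ?F c) = (\<lambda>xs. 0)"
      using comm[OF cF] restr_disjoint[OF c disj] fun_linear_zero[OF fun_linear_delta, of A] by simp
    have "delta ?F c = delta B c"
    proof
      fix xs
      show "delta ?F c xs = delta B c xs"
      proof (cases "set xs \<in> A")
        case True
        then show ?thesis using fun_cong[OF A, of xs] disj by (auto simp: restr_def delta_def)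
      qed (auto simp: delta_def)
    qed
    then have "y = delta ?F c" using y by simp
    then show "y \<in> {y \<in> ?I. restr A y = (\<lambda>xs. 0)}" using A cF by blast
  qed
  then have "rk B k \<le> vdim {y \<in> ?I. restr A y = (\<lambda>xs. 0)}"
    unfolding rk_def
  proof (intro vdim_mono)
    show "fun_subspace (delta B ` alt_cochains B k)"
      using fin_subspace_delta[OF fin(2)] by (simp add: fin_subspace_def)
    show "fin_subspace {y \<in> ?I. restr A y = (\<lambda>xs. 0)}"
      by (rule fin_subspace_kernel[OF I fun_linear_restr])
  qed
  moreover have "rk A k + vdim {y \<in> ?I. restr A y = (\<lambda>xs. 0)} = rk ?F k"
    using vdim_rank_nullity[OF I fun_linear_restr, of A] by (simp only: rk_def image)
  ultimately show ?thesis by linarith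
qed

text \<open>
  The dimensions of the cochain spaces are additive, so the difference of the two sides is \<open>(1 + t)\<close> times
  the excess of ranks. For a pair of complexes this excess is the rank of the connecting
  homomorphism of the long exact cohomology sequence.
\<close>

lemma family_betti_Un:
  assumes "finite (\<Union>A)" "finite (\<Union>B)" "A \<inter> B = {}"
    and "\<And>a b. a \<in> A \<Longrightarrow> b \<in> B \<Longrightarrow> \<not> b \<subseteq> a"
  shows "family_betti (A \<union> B) \<preceq> (\<lambda>k. family_betti A k + family_betti B k)"
  unfolding morse_le_def
proof (intro exI conjI allI)
  let ?r = "\<lambda>k. real (rk (A \<union> B) k) - (real (rk A k) + real (rk B k))"
  have "rk A k + rk B k \<le> rk (A \<union> B) k" for k
    by (rule rk_Un_ge) (fact assms)+
  then show "0 \<le> ?r k" for k by (simp flip: of_nat_add)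
  show "family_betti A k + family_betti B k - family_betti (A \<union> B) k = ?r k + shift ?r k" for k
    using vdim_alt_cochains_Un[OF assms(1-3), of k]
    by (cases k) (simp_all add: family_betti_def shift_def)
qed

text \<open>
  Here \<open>d d = 0\<close> enters: coboundaries are cocycles. This bound is what turns the inequalities into the
  exact computation of the cohomology of spheres.
\<close>

lemma family_betti_nonneg:
  assumes "finite (\<Union>F)" and F: "\<And>s t. s \<in> F \<Longrightarrow> t \<subseteq> s \<Longrightarrow> t \<in> F"
  shows "0 \<le> family_betti F k"
proof -
  let ?Z = "{c \<in> alt_cochains F k. delta F c = (\<lambda>xs. 0)}"
  have C: "fin_subspace (alt_cochains F k)" using assms(1) by (rule fin_subspace_alt_cochains)
  have Z: "fin_subspace ?Z"
    by (rule fin_subspace_kernel[OF C fun_linear_delta])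
  have "shift (\<lambda>j. real (rk F j)) k \<le> real (vdim ?Z)"
  proof (cases k)
    case (Suc j)
    have sub: "delta F ` alt_cochains F j \<subseteq> ?Z"
    proof (rule image_subsetI)
      fix c assume c: "c \<in> alt_cochains F j"
      then have "c \<in> alt_cochains UNIV j" using alt_cochains_mono[of F UNIV j] by blast
      then have "delta F (delta F c) = (\<lambda>xs. 0)" using F by (intro delta_delta)
      then show "delta F c \<in> ?Z" using delta_subset[of F j] c Suc by blast
    qed
    have "fun_subspace (delta F ` alt_cochains F j)"
      using fin_subspace_delta[OF assms(1)] unfolding fin_subspace_def by blast
    then have "rk F j \<le> vdim ?Z" unfolding rk_def using Z sub by (rule vdim_mono)
    then show ?thesis by (simp add: shift_def Suc)
  qed (simp add: shift_def)
  moreover have "rk F k + vdim ?Z = vdim (alt_cochains F k)"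
    unfolding rk_def by (rule vdim_rank_nullity[OF C fun_linear_delta])
  ultimately show ?thesis unfolding family_betti_def by linarith
qed

section \<open>The simplices containing a fixed vertex\<close>

text \<open>
  Interchanging \<open>x\<close> with the first entry brings it to the front of any ordering of a simplex containing it.
\<close>

lemma alt_cochains_eqI:
  assumes c: "c \<in> alt_cochains (insert x ` L) (Suc k)" and z: "\<And>ys. c (x # ys) = 0"
  shows "c = (\<lambda>xs. 0)"
proof (rule ext, rule ccontr)
  fix ys assume nz: "c ys \<noteq> 0"
  then have "x \<in> set ys" using alt_cochainsD(4)[OF c nz] by auto
  then obtain us vs where ys: "ys = us @ x # vs" by (meson split_list)
  show False
  proof (cases us)
    case Nil
    then show False using nz z ys by simp
  next
    case (Cons b us')
    then show False
      using nz z[of "us' @ b # vs"] ys alternatingD[OF alt_cochainsD(1)[OF c], of "[]" b us' x vs]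
      by simp
  qed
qed

text \<open>
  The face that omits \<open>x\<close> is separated from the faces that keep it. The value \<open>e\<close> of \<open>c\<close> on the former is a
  parameter because it is used in two situations: for a cochain on simplices containing \<open>x\<close> it is zero,
  for a cochain on simplices avoiding \<open>x\<close> it is the only surviving term.
\<close>

lemma delta_Cons:
  assumes "x \<notin> \<Union>L" "distinct (x # ys) \<Longrightarrow> set ys \<in> L \<Longrightarrow> c ys = e"
  shows "delta (insert x ` L) c (x # ys) =
    (if distinct ys \<and> set ys \<in> L then e - delta L (\<lambda>zs. c (x # zs)) ys else 0)"
proof -
  have *: "distinct (x # ys) \<and> set (x # ys) \<in> insert x ` L \<longleftrightarrow> distinct ys \<and> set ys \<in> L"
  proof
    assume "distinct (x # ys) \<and> set (x # ys) \<in> insert x ` L"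
    then obtain s where "s \<in> L" "insert x (set ys) = insert x s" "x \<notin> set ys" "distinct ys" by auto
    moreover from this have "x \<notin> s" using assms(1) by blast
    ultimately show "distinct ys \<and> set ys \<in> L" by (metis insert_ident)
  qed (use assms(1) in auto)
  show ?thesis
  proof (cases "distinct ys \<and> set ys \<in> L")
    case True
    then have "delta (insert x ` L) c (x # ys) =
        (\<Sum>i<Suc (length ys). (- 1) ^ i * c (take i (x # ys) @ drop (Suc i) (x # ys)))"
      using * unfolding delta_def by simp
    also have "\<dots> = c ys - (\<Sum>i<length ys. (- 1) ^ i * c (x # take i ys @ drop (Suc i) ys))"
      by (subst sum.lessThan_Suc_shift) (simp add: sum_negf)
    finally show ?thesis using True * assms(2) by (simp add: delta_def)
  qed (use * in \<open>auto simp: delta_def\<close>)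
qed

lemma alt_cochains_trivial:
  assumes "\<And>xs. distinct xs \<Longrightarrow> length xs = k \<Longrightarrow> set xs \<notin> F"
  shows "alt_cochains F k = {\<lambda>xs. 0}"
proof -
  have "c xs = 0" if "c \<in> alt_cochains F k" for c xs
    using alt_cochainsD(2-4)[OF that, of xs] assms[of xs] by blast
  moreover have "(\<lambda>xs. 0) \<in> alt_cochains F k" by (simp add: alt_cochains_def alternating_zero)
  ultimately show ?thesis by blast
qed

lemma alt_cochains_0: "{} \<notin> F \<Longrightarrow> alt_cochains F 0 = {\<lambda>xs. 0}"
  by (rule alt_cochains_trivial) simp

lemma vdim_alt_cochains_0: "{} \<notin> F \<Longrightarrow> vdim (alt_cochains F 0) = 0"
  by (simp add: alt_cochains_0 vdim_zero)

lemma rk_0: "{} \<notin> F \<Longrightarrow> rk F 0 = 0"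
  by (simp add: rk_def alt_cochains_0 fun_linear_zero[OF fun_linear_delta] vdim_zero)

text \<open>
  Evaluation on orderings beginning with \<open>x\<close> identifies cochains on the sets \<open>insert x s\<close> for \<open>s \<in> L\<close> with
  cochains on \<open>L\<close> of one degree less, and it commutes with the coboundary up to sign. If \<open>L\<close> is the
  augmented complex of the link of \<open>x\<close>, this says that the relative cohomology of adding \<open>x\<close> is the reduced
  cohomology of the link, shifted by one.
\<close>

lemma family_betti_cone:
  assumes x: "x \<notin> \<Union>L" and fin: "finite (\<Union>L)"
  shows "family_betti (insert x ` L) 0 = 0"
    and "family_betti (insert x ` L) (Suc k) = family_betti L k"
proof -
  let ?F = "insert x ` L"
  define T where "T = (\<lambda>(c :: 'a list \<Rightarrow> real) ys. c (x # ys))"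
  have finF: "finite (\<Union>?F)" by (rule finite_subset[of _ "insert x (\<Union>L)"]) (use fin in auto)
  have lin: "fun_linear T" by (simp add: fun_linear_def T_def)
  have inj: "c = (\<lambda>xs. 0)" if "c \<in> alt_cochains ?F (Suc k)" "T c = (\<lambda>ys. 0)" for c k
    using alt_cochains_eqI[OF that(1)] that(2) by (metis T_def)
  have image: "T ` alt_cochains ?F (Suc k) = alt_cochains L k" for k
  proof
    show "T ` alt_cochains ?F (Suc k) \<subseteq> alt_cochains L k"
    proof (rule image_subsetI)
      fix c assume c: "c \<in> alt_cochains ?F (Suc k)"
      have "alternating (T c)"
        unfolding alternating_def T_def
      proof (intro allI)
        show "c (x # xs @ b # ys @ a # zs) = - c (x # xs @ a # ys @ b # zs)" for xs a ys b zs
          using alternatingD[OF alt_cochainsD(1)[OF c], of "x # xs" b ys a zs] by simp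
      qed
      moreover have "distinct ys \<and> length ys = k \<and> set ys \<in> L" if nz: "c (x # ys) \<noteq> 0" for ys
      proof -
        obtain s where "s \<in> L" "insert x (set ys) = insert x s" "x \<notin> set ys"
          using alt_cochainsD(2,4)[OF c nz] by auto
        moreover from this have "x \<notin> s" using x by blast
        ultimately have "set ys \<in> L" by (metis insert_ident)
        then show ?thesis using alt_cochainsD(2,3)[OF c nz] by auto
      qed
      ultimately show "T c \<in> alt_cochains L k" by (simp add: alt_cochains_def T_def)
    qed
    show "alt_cochains L k \<subseteq> T ` alt_cochains ?F (Suc k)"
    proof
      fix e assume e: "e \<in> alt_cochains L k"
      \<comment> \<open>a preimage of \<open>e\<close> is its own coboundary, cut down to the simplices containing \<open>x\<close>\<close>
      have e0: "(\<lambda>zs. e (x # zs)) = (\<lambda>zs. 0)" 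
      proof (rule ext, rule ccontr)
        show False if "e (x # zs) \<noteq> 0" for zs using alt_cochainsD(4)[OF e that] x by auto
      qed
      have "T (delta ?F e) = e"
      proof
        show "T (delta ?F e) ys = e ys" for ys
          using delta_Cons[OF x, of ys e "e ys"] alt_cochainsD(2,4)[OF e, of ys]
            fun_linear_zero[OF fun_linear_delta, of L] by (auto simp: T_def e0)
      qed
      moreover have "delta ?F e \<in> alt_cochains ?F (Suc k)"
        using delta_closed e alt_cochains_mono[of L UNIV k] by blast
      ultimately show "e \<in> T ` alt_cochains ?F (Suc k)" by (metis image_eqI)
    qed
  qed
  have dim: "vdim (alt_cochains ?F (Suc k)) = vdim (alt_cochains L k)" for k
  proof -
    have "vdim (T ` alt_cochains ?F (Suc k)) = vdim (alt_cochains ?F (Suc k))"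
      by (rule vdim_image_inj[OF fin_subspace_alt_cochains[OF finF] lin]) (rule inj)
    then show ?thesis by (simp add: image)
  qed
  have comm: "T (delta ?F c) = delta L (\<lambda>ys. - 1 * T c ys)" if c: "c \<in> alt_cochains ?F (Suc k)" for c k
  proof
    fix ys
    have "c ys = 0" if "x \<notin> set ys" using alt_cochainsD(4)[OF c, of ys] that by blast
    then have "T (delta ?F c) ys = (if distinct ys \<and> set ys \<in> L then 0 - delta L (T c) ys else 0)"
      unfolding T_def by (intro delta_Cons[OF x]) auto
    also have "\<dots> = - 1 * delta L (T c) ys" by (auto simp: delta_def)
    also have "\<dots> = delta L (\<lambda>ys. - 1 * T c ys) ys"
      using fun_linear_delta[of L] by (simp only: fun_linear_def)
    finally show "T (delta ?F c) ys = delta L (\<lambda>ys. - 1 * T c ys) ys" .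
  qed
  have rk: "rk ?F (Suc k) = rk L k" for k
  proof -
    have neg: "(\<lambda>c ys. - 1 * c ys) ` alt_cochains L k = alt_cochains L k"
    proof -
      have "(\<lambda>ys. - 1 * c ys) \<in> alt_cochains L k" if "c \<in> alt_cochains L k" for c
        using that alternating_smult[of c "- 1"] by (auto simp: alt_cochains_def)
      note closed = this
      have "c \<in> (\<lambda>c ys. - 1 * c ys) ` alt_cochains L k" if "c \<in> alt_cochains L k" for c
        by (rule image_eqI[OF _ closed[OF that]]) simp
      then show ?thesis using closed by blast
    qed
    have "T ` delta ?F ` alt_cochains ?F (Suc k) =
        delta L ` (\<lambda>c ys. - 1 * c ys) ` T ` alt_cochains ?F (Suc k)"
      unfolding image_image using comm by (intro image_cong) auto
    also have "\<dots> = delta L ` alt_cochains L k" by (simp only: image neg)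
    finally have "rk L k = vdim (T ` delta ?F ` alt_cochains ?F (Suc k))" by (simp only: rk_def)
    also have "\<dots> = vdim (delta ?F ` alt_cochains ?F (Suc k))"
      using inj[of _ "Suc k"] delta_subset[of ?F "Suc k"]
      by (intro vdim_image_inj fin_subspace_delta finF lin) blast
    finally show ?thesis by (simp only: rk_def)
  qed
  have 0: "vdim (alt_cochains ?F 0) = 0" "rk ?F 0 = 0"
    by (auto intro!: vdim_alt_cochains_0 rk_0)
  then show "family_betti ?F 0 = 0" by (simp add: family_betti_def shift_def)
  have "shift (\<lambda>j. real (rk ?F j)) (Suc k) = shift (\<lambda>j. real (rk L j)) k"
    using 0 rk by (cases k) (simp_all add: shift_def)
  then show "family_betti ?F (Suc k) = family_betti L k" by (simp add: family_betti_def dim rk)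
qed

lemma morse_le_trans [trans]:
  assumes "a \<preceq> b" "b \<preceq> c"
  shows "a \<preceq> c"
proof -
  obtain r s where r: "\<And>k. 0 \<le> r k" "\<And>k. b k - a k = r k + shift r k"
    and s: "\<And>k. 0 \<le> s k" "\<And>k. c k - b k = s k + shift s k"
    using assms unfolding morse_le_def by blast
  have "c k - a k = (r k + s k) + shift (\<lambda>k. r k + s k) k" for k
    using r(2)[of k] s(2)[of k] by (cases k) (simp_all add: shift_def)
  then show ?thesis
    unfolding morse_le_def using r(1) s(1) by (intro exI[of _ "\<lambda>k. r k + s k"]) simp
qed

lemma morse_le_add_right:
  assumes "a \<preceq> b"
  shows "(\<lambda>k. a k + c k) \<preceq> (\<lambda>k. b k + c k)"
  using assms by (simp add: morse_le_def)

lemma morse_le_refl: "a \<preceq> a"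
  unfolding morse_le_def by (intro exI[of _ "\<lambda>k. 0"]) (simp add: shift_def split: nat.split)

lemma shift_zero: "shift (\<lambda>k. 0) k = 0"
  by (simp add: shift_def split: nat.split)

lemma shift_nonneg: "(\<And>k. 0 \<le> r k) \<Longrightarrow> 0 \<le> shift r k"
  by (simp add: shift_def split: nat.split)

text \<open>
  A nonnegative sequence below a single power of \<open>t\<close> equals it: a positive coefficient of \<open>r\<close> would
  contribute to two neighbouring coefficients of \<open>(1 + t) r\<close>. For negative \<open>m\<close> the upper bound is zero, which
  covers acyclicity.
\<close>

lemma morse_le_at_most_one:
  assumes b: "\<And>k. 0 \<le> b k" and le: "b \<preceq> (\<lambda>k. of_bool (int k = m))"
  shows "b k = of_bool (int k = m)"
proof -
  obtain r where r: "\<And>k. 0 \<le> r k" "\<And>k. of_bool (int k = m) - b k = r k + shift r k"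
    using le unfolding morse_le_def by blast
  have z: "b k = 0 \<and> r k = 0 \<and> shift r k = 0" if "int k \<noteq> m" for k
    using r(2)[of k] r(1)[of k] b[of k] shift_nonneg[of r k, OF r(1)] that by (simp; linarith)
  show ?thesis
  proof (cases "int k = m")
    case True
    then have "r k = 0" using z[of "Suc k"] by (simp add: shift_def)
    moreover have "shift r k = 0"
    proof (cases k)
      case (Suc j)
      then show ?thesis using z[of j] True by (simp add: shift_def)
    qed (simp add: shift_def)
    ultimately show ?thesis using r(2)[of k] True by simp
  next
    case False
    then show ?thesis using z by simp
  qed
qed

lemma family_betti_empty: "family_betti {} k = 0"
proof -
  have *: "alt_cochains {} k = {\<lambda>xs :: 'a list. 0}" for k by (rule alt_cochains_trivial) simp
  have "rk ({} :: 'a set set) k = 0" for k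
    by (simp add: rk_def * vdim_zero fun_linear_zero[OF fun_linear_delta])
  then show ?thesis by (cases k) (simp_all add: family_betti_def * vdim_zero shift_def)
qed

lemma vdim_alt_cochains_base: "{} \<in> F \<Longrightarrow> vdim (alt_cochains F 0) = 1"
proof -
  assume F: "{} \<in> F"
  have "alt_cochains F 0 = {c. \<forall>xs. xs \<noteq> [] \<longrightarrow> c xs = 0}"
  proof (intro subset_antisym subsetI)
    show "c \<in> {c. \<forall>xs. xs \<noteq> [] \<longrightarrow> c xs = 0}" if "c \<in> alt_cochains F 0" for c
      using alt_cochainsD(3)[OF that] by auto
    show "c \<in> alt_cochains F 0" if "c \<in> {c. \<forall>xs. xs \<noteq> [] \<longrightarrow> c xs = 0}" for c
    proof (rule alt_cochainsI_short)
      show "length xs = 0 \<and> set xs \<in> F" if "c xs \<noteq> 0" for xs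
        using that \<open>c \<in> _\<close> F by (cases "xs = []") auto
    qed simp
  qed
  then show ?thesis by (simp add: vdim_supported_singleton)
qed

text \<open>
  The augmented complex of the empty graph.
\<close>

lemma family_betti_singleton_empty: "family_betti ({{}} :: 'a set set) = (\<lambda>k. of_bool (k = 0))"
proof -
  have "alt_cochains {{}} (Suc k) = {\<lambda>xs :: 'a list. 0}" for k
    by (rule alt_cochains_trivial) auto
  then have dim: "vdim (alt_cochains ({{}} :: 'a set set) k) = of_bool (k = 0)" for k
    using vdim_alt_cochains_base[of "{{}} :: 'a set set"] by (cases k) (simp_all add: vdim_zero)
  have "delta {{}} c = (\<lambda>xs :: 'a list. 0)" for c by (auto simp: delta_def)
  then have "delta {{}} ` alt_cochains {{}} k = {\<lambda>xs :: 'a list. 0}" for k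
    using fin_subspace_alt_cochains[of "{{}} :: 'a set set" k] by (auto simp: fin_subspace_def fun_subspace_def)
  then have "rk ({{}} :: 'a set set) k = 0" for k by (simp add: rk_def vdim_zero)
  then show ?thesis using dim by (simp add: family_betti_def shift_def fun_eq_iff split: nat.split)
qed

lemma family_betti_insert_cone:
  assumes fin: "finite (\<Union>A)" "finite (\<Union>L)" and v: "v \<notin> \<Union>A" "v \<notin> \<Union>L"
  shows "family_betti (A \<union> insert v ` L) \<preceq> (\<lambda>k. family_betti A k + shift (family_betti L) k)"
proof -
  have "family_betti (insert v ` L) k = shift (family_betti L) k" for k
    using family_betti_cone[OF v(2) fin(2)] by (cases k) (simp_all add: shift_def)
  moreover have "family_betti (A \<union> insert v ` L) \<preceq>
      (\<lambda>k. family_betti A k + family_betti (insert v ` L) k)"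
  proof (rule family_betti_Un)
    show "finite (\<Union>(insert v ` L))"
      by (rule finite_subset[of _ "insert v (\<Union>L)"]) (use fin in auto)
  qed (use fin v in auto)
  ultimately show ?thesis by simp
qed

section \<open>Contractible graphs and Evako spheres\<close>

text \<open>
  The augmented Whitney complex, whose cohomology is the reduced cohomology of the graph.
\<close>

definition cliques :: "('a, 'b) pre_digraph \<Rightarrow> 'a set set" where
  "cliques G = insert {} (whitney_complex G)"

lemma Union_whitney_complex: "\<Union>(whitney_complex G) \<subseteq> verts G"
  by (auto simp: whitney_complex_def)

lemma Union_cliques: "\<Union>(cliques G) \<subseteq> verts G"
  using Union_whitney_complex[of G] by (simp add: cliques_def)

lemma dominates_induce_subgraph:
  "u \<rightarrow>\<^bsub>G \<restriction> A\<^esub> v \<longleftrightarrow> u \<in> A \<and> v \<in> A \<and> u \<rightarrow>\<^bsub>G\<^esub> v"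
  by (auto simp: arcs_ends_def arc_to_ends_def)

lemma verts_remove_vertex [simp]: "verts (remove_vertex G v) = verts G - {v}"
  by (simp add: remove_vertex_def)

text \<open>
  A clique either avoids \<open>v\<close> or is \<open>v\<close> together with a possibly empty clique of the unit sphere. The empty
  clique accounts for the vertex \<open>v\<close> itself; this is why the second part is augmented also when the complex is not.
\<close>

lemma whitney_complex_remove_vertex:
  assumes "graph G" "v \<in> verts G"
  shows "whitney_complex G =
    whitney_complex (remove_vertex G v) \<union> insert v ` cliques (unit_sphere G v)"
proof (intro subset_antisym subsetI)
  interpret graph G by fact
  fix W
  {
    assume W: "W \<in> whitney_complex G"
    show "W \<in> whitney_complex (remove_vertex G v) \<union> insert v ` cliques (unit_sphere G v)"
    proof (cases "v \<in> W")
      case True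
      then have "W = insert v (W - {v})" by blast
      moreover have "W - {v} \<in> cliques (unit_sphere G v)"
        using W True
        by (auto simp: cliques_def whitney_complex_def unit_sphere_def dominates_induce_subgraph)
      ultimately show ?thesis by blast
    next
      case False
      then show ?thesis
        using W by (auto simp: whitney_complex_def remove_vertex_def dominates_induce_subgraph)
    qed
  next
    assume "W \<in> whitney_complex (remove_vertex G v) \<union> insert v ` cliques (unit_sphere G v)"
    then show "W \<in> whitney_complex G"
    proof
      assume "W \<in> whitney_complex (remove_vertex G v)"
      then show ?thesis
        by (auto simp: whitney_complex_def remove_vertex_def dominates_induce_subgraph)
    next
      assume "W \<in> insert v ` cliques (unit_sphere G v)"
      then obtain s where s: "W = insert v s" "s \<in> cliques (unit_sphere G v)" by blast
      have sym: "y \<rightarrow>\<^bsub>G\<^esub> x" if "x \<rightarrow>\<^bsub>G\<^esub> y" for x y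
        using arcs_ends_symmetric[OF sym_arcs] that by simp
      have "s \<subseteq> {y \<in> verts G. v \<rightarrow>\<^bsub>G\<^esub> y}"
        using s(2) Union_cliques[of "unit_sphere G v"] by (auto simp: unit_sphere_def)
      moreover have "x \<rightarrow>\<^bsub>G\<^esub> y" if "x \<in> s" "y \<in> s" "x \<noteq> y" for x y
        using s(2) that
        by (auto simp: cliques_def whitney_complex_def unit_sphere_def dominates_induce_subgraph)
      ultimately show ?thesis
        using s(1) assms(2) sym by (auto simp: whitney_complex_def)
    qed
  }
qed

lemma family_betti_remove_vertex:
  assumes G: "graph G" and v: "v \<in> verts G"
  shows "family_betti (whitney_complex G) \<preceq> (\<lambda>k. family_betti (whitney_complex (remove_vertex G v)) k +
      shift (family_betti (cliques (unit_sphere G v))) k)" (is ?W)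
    and "family_betti (cliques G) \<preceq> (\<lambda>k. family_betti (cliques (remove_vertex G v)) k +
      shift (family_betti (cliques (unit_sphere G v))) k)" (is ?C)
proof -
  interpret graph G by fact
  let ?A = "whitney_complex (remove_vertex G v)" and ?L = "cliques (unit_sphere G v)"
  have A: "\<Union>?A \<subseteq> verts G - {v}"
    using Union_whitney_complex[of "remove_vertex G v"] by (simp add: remove_vertex_def)
  have "\<Union>?L \<subseteq> {y \<in> verts G. v \<rightarrow>\<^bsub>G\<^esub> y}"
    using Union_cliques[of "unit_sphere G v"] by (simp add: unit_sphere_def)
  then have L: "\<Union>?L \<subseteq> verts G" "v \<notin> \<Union>?L" using adj_not_same by auto
  have fin: "finite (\<Union>?A)" "finite (\<Union>?L)" using A L finite_subset[OF _ finite_verts] by blast+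
  show ?W unfolding whitney_complex_remove_vertex[OF G v]
    by (rule family_betti_insert_cone[OF fin]) (use A L in auto)
  have "cliques G = insert {} ?A \<union> insert v ` ?L"
    unfolding cliques_def[of G] whitney_complex_remove_vertex[OF G v] by blast
  moreover have "family_betti (insert {} ?A \<union> insert v ` ?L) \<preceq>
      (\<lambda>k. family_betti (insert {} ?A) k + shift (family_betti ?L) k)"
    by (rule family_betti_insert_cone) (use fin A L in auto)
  ultimately show ?C by (simp add: cliques_def)
qed

lemma family_betti_cliques_nonneg:
  assumes "finite (verts G)"
  shows "0 \<le> family_betti (cliques G) k"
proof (rule family_betti_nonneg)
  show "finite (\<Union>(cliques G))" using finite_subset[OF Union_cliques assms] .
  show "t \<in> cliques G" if "s \<in> cliques G" "t \<subseteq> s" for s t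
    using that by (auto simp: cliques_def whitney_complex_def)
qed

text \<open>
  Splitting off the only vertex bounds the Betti numbers by those of \<open>1 + t\<close>. The coboundary from
  the empty simplex to the vertex is injective, so the coefficient of \<open>r\<close> in degree 0 is one, and
  this exhausts the bound.
\<close>

lemma family_betti_one_vertex:
  assumes G: "graph G" and V: "verts G = {v}"
  shows "family_betti (cliques G) k = 0"
proof -
  interpret graph G by fact
  have unit: "cliques (unit_sphere G v) = {{}}"
    using Union_cliques[of "unit_sphere G v"] adj_not_same
    by (auto simp: cliques_def whitney_complex_def unit_sphere_def V)
  have rest: "cliques (remove_vertex G v) = {{}}"
    by (auto simp: cliques_def whitney_complex_def remove_vertex_def V)
  obtain r where r: "\<And>k. 0 \<le> r k"
    "\<And>k. of_bool (k = 0) + shift (\<lambda>k. of_bool (k = 0)) k - family_betti (cliques G) k = r k + shift r k"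
    using family_betti_remove_vertex(2)[OF G, of v] V
    unfolding unit rest family_betti_singleton_empty morse_le_def by blast
  have nonneg: "0 \<le> family_betti (cliques G) k" for k
    by (rule family_betti_cliques_nonneg) simp
  have fin: "finite (\<Union>(cliques G))" using finite_subset[OF Union_cliques finite_verts] .
  have F: "{v} \<in> cliques G" "{} \<in> cliques G" by (auto simp: cliques_def whitney_complex_def V)
  have "rk (cliques G) 0 = vdim (alt_cochains (cliques G) 0)"
    unfolding rk_def
  proof (rule vdim_image_inj[OF fin_subspace_alt_cochains[OF fin] fun_linear_delta])
    fix c assume c: "c \<in> alt_cochains (cliques G) 0" and z: "delta (cliques G) c = (\<lambda>xs. 0)"
    have "delta (cliques G) c [v] = c []" using F by (simp add: delta_def)
    then have "c [] = 0" by (simp add: z)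
    then show "c = (\<lambda>xs. 0)" using alt_cochainsD(3)[OF c] by (metis ext length_0_conv)
  qed
  then have b0: "family_betti (cliques G) 0 = 0" by (simp add: family_betti_def shift_def)
  have r0: "r 0 = 1" using r(2)[of 0] b0 by (simp add: shift_def)
  show ?thesis
  proof (cases k)
    case (Suc j)
    then show ?thesis
      using r(2)[of k] r0 r(1)[of k] r(1)[of j] nonneg[of k] by (cases j) (simp_all add: shift_def)
  qed (simp add: b0)
qed

lemma family_betti_contractible:
  "contractible G \<Longrightarrow> family_betti (cliques G) k = 0"
proof (induction arbitrary: k rule: contractible.induct)
  case (one_vertex G v)
  then show ?case by (rule family_betti_one_vertex)
next
  case (extend G v)
  interpret graph G by fact
  have zero: "family_betti (cliques (unit_sphere G v)) = (\<lambda>k. 0)"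
    "family_betti (cliques (remove_vertex G v)) = (\<lambda>k. 0)"
    using extend.IH by auto
  have "family_betti (cliques G) \<preceq> (\<lambda>k. of_bool (int k = -1))"
    using family_betti_remove_vertex(2)[OF extend(1,2)] by (simp add: zero shift_zero)
  from morse_le_at_most_one[OF family_betti_cliques_nonneg[OF finite_verts] this] show ?case by simp
qed

text \<open>
  A \<open>k\<close>-sphere consists of an acyclic graph, namely the sphere without a suitable vertex, and the cone over
  the unit sphere of that vertex, which is a \<open>(k - 1)\<close>-sphere. So its reduced cohomology is bounded by, and
  hence equal to, the shifted cohomology of the smaller sphere. The bound \<open>0 \<le> m\<close> and the graph
  property are carried through the induction together with the statement on unit spheres.
\<close>

lemma family_betti_evako_sphere:
  "evako_graph m G \<Longrightarrow> 0 \<le> m \<and> graph G \<and> (\<forall>x\<in>verts G. \<forall>k.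
    family_betti (cliques (unit_sphere G x)) k = of_bool (int k = m))"
  "evako_sphere m G \<Longrightarrow> family_betti (cliques G) k = of_bool (int k = m + 1)"
proof (induction arbitrary: and k rule: evako_graph_evako_sphere.inducts)
  case (empty_sphere G)
  then have "cliques G = {{}}" by (auto simp: cliques_def whitney_complex_def)
  then show ?case by (simp add: family_betti_singleton_empty)
next
  case (k_graph m G)
  then show ?case by simp
next
  case (k_sphere m G v)
  interpret graph G using k_sphere by blast
  have "shift (\<lambda>k. of_bool (int k = m)) k = of_bool (int k = m + 1)" for k
    using k_sphere.IH by (cases k) (auto simp: shift_def)
  moreover have "family_betti (cliques (unit_sphere G v)) = (\<lambda>k. of_bool (int k = m))"
    using k_sphere by auto
  moreover have "family_betti (cliques (remove_vertex G v)) = (\<lambda>k. 0)"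
    using family_betti_contractible[OF k_sphere(3)] by auto
  moreover have "family_betti (cliques G) \<preceq> (\<lambda>k. family_betti (cliques (remove_vertex G v)) k +
      shift (family_betti (cliques (unit_sphere G v))) k)"
    using k_sphere by (intro family_betti_remove_vertex) auto
  ultimately have "family_betti (cliques G) \<preceq> (\<lambda>k. of_bool (int k = m + 1))"
    by simp
  from morse_le_at_most_one[OF family_betti_cliques_nonneg[OF finite_verts] this] show ?case .
qed

section \<open>The strong Morse inequalities\<close>

lemma graph_remove_vertex:
  assumes "graph G"
  shows "graph (remove_vertex G v)"
proof -
  interpret graph G by fact
  have "induced_subgraph (remove_vertex G v) G"
    unfolding remove_vertex_def by (rule induced_induce) blast
  from digraphI_induced[OF this] induced_graph_imp_graph[OF this] show ?thesis
    by (simp add: graph_def pseudo_graph_def digraph_def)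
qed

lemma induce_subgraph_induce_subgraph: "B \<subseteq> A \<Longrightarrow> (G \<restriction> A) \<restriction> B = G \<restriction> B"
  by (auto simp: induce_subgraph_def)

lemma stable_sphere_remove_vertex:
  assumes "y \<in> verts G" "y \<noteq> x" "f y \<le> f x"
  shows "stable_sphere (remove_vertex G x) f y = stable_sphere G f y"
proof -
  have "{z \<in> verts (unit_sphere (remove_vertex G x) y). f z < f y} =
      {z \<in> verts (unit_sphere G y). f z < f y}" (is "?S = ?T")
    using assms by (auto simp: unit_sphere_def remove_vertex_def dominates_induce_subgraph)
  moreover have "?T \<subseteq> verts G - {x}" using assms by (auto simp: unit_sphere_def)
  ultimately show ?thesis
    by (simp add: stable_sphere_def remove_vertex_def induce_subgraph_induce_subgraph)
qed

text \<open>
  At a vertex with maximal value local injectivity makes all neighbours strictly smaller.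
\<close>

lemma stable_sphere_max:
  assumes "morse_function G f" "x \<in> verts G" "\<And>y. y \<in> verts G \<Longrightarrow> f y \<le> f x"
  shows "stable_sphere G f x = unit_sphere G x"
proof -
  have "{y \<in> verts (unit_sphere G x). f y < f x} = {y \<in> verts G. x \<rightarrow>\<^bsub>G\<^esub> y}"
    using assms by (fastforce simp: unit_sphere_def morse_function_def)
  then show ?thesis by (simp add: stable_sphere_def unit_sphere_def)
qed

lemma morse_function_remove_vertex:
  assumes "morse_function G f" "\<And>y. y \<in> verts G \<Longrightarrow> f y \<le> f x"
  shows "morse_function (remove_vertex G x) f"
proof -
  have V: "verts (remove_vertex G x) = verts G - {x}" by (simp add: remove_vertex_def)
  have "\<exists>m\<ge>-1. evako_sphere m (stable_sphere (remove_vertex G x) f y)"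
    if "y \<in> verts G - {x}" for y
    using assms that by (subst stable_sphere_remove_vertex) (auto simp: morse_function_def)
  moreover have "f y \<noteq> f z" if "y \<in> verts G - {x}" "z \<in> verts G - {x}"
    "y \<rightarrow>\<^bsub>remove_vertex G x\<^esub> z" for y z
    using assms(1) that by (auto simp: morse_function_def remove_vertex_def dominates_induce_subgraph)
  ultimately show ?thesis by (simp add: morse_function_def V)
qed

lemma num_critical_remove_vertex:
  assumes "finite (verts G)" "x \<in> verts G" "\<And>y. y \<in> verts G \<Longrightarrow> f y \<le> f x"
  shows "num_critical G f k =
    num_critical (remove_vertex G x) f k + of_bool (morse_index G f x = int k)"
proof -
  have idx: "morse_index (remove_vertex G x) f y = morse_index G f y" if "y \<in> verts G - {x}" for y
    using assms that by (simp add: morse_index_def stable_sphere_remove_vertex)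
  have "{y \<in> verts G. morse_index G f y = int k} =
      {y \<in> verts (remove_vertex G x). morse_index (remove_vertex G x) f y = int k} \<union>
      (if morse_index G f x = int k then {x} else {})" (is "?L = ?R")
  proof (rule Set.set_eqI)
    show "y \<in> ?L \<longleftrightarrow> y \<in> ?R" for y
      using idx[of y] assms(2) by (cases "y = x") auto
  qed
  moreover have "x \<notin> {y \<in> verts (remove_vertex G x). morse_index (remove_vertex G x) f y = int k}"
    by simp
  moreover have "finite {y \<in> verts (remove_vertex G x). morse_index (remove_vertex G x) f y = int k}"
    using assms(1) by simp
  ultimately show ?thesis by (simp add: num_critical_def)
qed

text \<open>
  Induction removing a vertex with maximal value of \<open>f\<close>. Its unit sphere is its stable sphere, hence an
  \<open>m\<close>-sphere, so it contributes exactly \<open>t\<close> to the power of the Morse index, and the stable spheres of all other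
  vertices are unchanged. The maximum need not be unique. The shift on the right translates from dimension to the
  number of vertices of a simplex.
\<close>

lemma family_betti_le_num_critical:
  assumes "graph G" "morse_function G f"
  shows "family_betti (whitney_complex G) \<preceq> shift (\<lambda>k. real (num_critical G f k))"
  using assms
proof (induction "card (verts G)" arbitrary: G)
  case 0
  interpret graph G by fact
  have V: "verts G = {}" using 0 by simp
  then have "whitney_complex G = {}" by (auto simp: whitney_complex_def)
  then have "family_betti (whitney_complex G) = shift (\<lambda>k. real (num_critical G f k))"
    using V by (auto simp: family_betti_empty num_critical_def shift_def split: nat.split)
  then show ?case by (simp add: morse_le_refl)
next
  case (Suc n)
  interpret graph G by fact
  have ne: "verts G \<noteq> {}" using Suc.hyps(2) by auto
  have "Max (f ` verts G) \<in> f ` verts G" using ne by (intro Max_in) auto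
  then obtain x where x1: "x \<in> verts G" and max: "Max (f ` verts G) = f x" by auto
  have x2: "f y \<le> f x" if "y \<in> verts G" for y
    using that by (simp flip: max)
  note x = x1 x2
  let ?G = "remove_vertex G x"
  have "verts ?G = verts G - {x}" by (simp add: remove_vertex_def)
  then have card: "n = card (verts ?G)" using Suc.hyps(2) x(1) by simp
  have IH: "family_betti (whitney_complex ?G) \<preceq> shift (\<lambda>k. real (num_critical ?G f k))"
    using Suc.hyps(1)[OF card graph_remove_vertex morse_function_remove_vertex]
      Suc.prems x(2) by blast
  obtain m where m: "m \<ge> -1" "evako_sphere m (unit_sphere G x)"
    using Suc.prems(2) x(1) stable_sphere_max[OF Suc.prems(2) x]
    by (auto simp: morse_function_def)
  then have idx: "morse_index G f x = m + 1"
    using stable_sphere_max[OF Suc.prems(2) x] by (intro morse_index_eq) simp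
  have sphere: "family_betti (cliques (unit_sphere G x)) = (\<lambda>k. of_bool (morse_index G f x = int k))"
    using family_betti_evako_sphere(2)[OF m(2)] idx by auto
  have "family_betti (whitney_complex G) \<preceq> (\<lambda>k. family_betti (whitney_complex ?G) k +
      shift (\<lambda>k. of_bool (morse_index G f x = int k)) k)"
    using family_betti_remove_vertex(1)[OF Suc.prems(1) x(1)] by (simp add: sphere)
  also have "\<dots> \<preceq> (\<lambda>k. shift (\<lambda>k. real (num_critical ?G f k)) k +
      shift (\<lambda>k. of_bool (morse_index G f x = int k)) k)"
    using IH by (rule morse_le_add_right)
  also have "\<dots> = shift (\<lambda>k. real (num_critical G f k))"
  proof -
    have "num_critical G f k = num_critical ?G f k + of_bool (morse_index G f x = int k)" for k
      by (rule num_critical_remove_vertex) (use x in auto)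
    then show ?thesis by (auto simp: shift_def split: nat.split)
  qed
  finally show ?case .
qed

text \<open>
  The dimension of cocycles modulo coboundaries, rewritten by the rank-nullity theorem for the
  projection and for the coboundary.
\<close>

lemma betti_eq_family_betti:
  assumes "graph G"
  shows "real (betti G k) = family_betti (whitney_complex G) (Suc k)"
proof -
  interpret graph G by fact
  let ?W = "whitney_complex G"
  have fin: "finite (\<Union>?W)" using finite_subset[OF Union_whitney_complex finite_verts] .
  have ne: "{} \<notin> ?W" by (simp add: whitney_complex_def)
  have C: "carrier (cochain_space G k) = alt_cochains ?W (Suc k)" for k
    by (auto simp: carrier_cochain_space ordered_simplices_def alt_cochains_def)
  have d: "coboundary G k c = delta ?W c" if c: "c \<in> alt_cochains ?W (Suc k)" for c k
  proof
    fix xs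
    show "coboundary G k c xs = delta ?W c xs"
    proof (cases "xs \<in> ordered_simplices G (k + 1)")
      case True
      then show ?thesis
        by (simp add: coboundary_def delta_def ordered_simplices_def lessThan_Suc_atMost)
    next
      case False
      then show ?thesis
        using delta_support[OF c, of ?W xs] by (auto simp: coboundary_def ordered_simplices_def)
    qed
  qed
  let ?Z = "{c \<in> alt_cochains ?W (Suc k). delta ?W c = (\<lambda>xs. 0)}"
  have Z: "cocycles G k = ?Z" using d by (auto simp: cocycles_def C)
  have sub: "cochain_space G k\<lparr>carrier := S\<rparr> = function_space\<lparr>carrier := S\<rparr>" for S
    by (simp add: cochain_space_def function_space_def)
  have finZ: "fin_subspace ?Z"
    by (rule fin_subspace_kernel[OF fin_subspace_alt_cochains[OF fin] fun_linear_delta])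
  have B: "vdim (coboundaries G k) = rk ?W k"
  proof (cases k)
    case 0
    then show ?thesis by (simp add: vdim_zero rk_0[OF ne])
  next
    case (Suc j)
    have "coboundary G j ` carrier (cochain_space G j) = delta ?W ` alt_cochains ?W (Suc j)"
      unfolding C using d by (intro image_cong) auto
    then show ?thesis by (simp add: Suc rk_def)
  qed
  have "vectorspace.dim class_ring (quotient_module (function_space\<lparr>carrier := ?Z\<rparr>) (coboundaries G k)) +
      vectorspace.dim class_ring (function_space\<lparr>carrier := ?Z\<rparr>\<lparr>carrier := coboundaries G k\<rparr>) =
      vectorspace.dim class_ring (function_space\<lparr>carrier := ?Z\<rparr>)"
  proof (rule dim_quotient_module)
    show "vectorspace class_ring (function_space\<lparr>carrier := ?Z\<rparr>)"
      using finZ by (intro vectorspace_fun_subspace) (simp add: fin_subspace_def)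
    show "vectorspace.fin_dim class_ring (function_space\<lparr>carrier := ?Z\<rparr>)"
      using finZ by (rule fin_dim_fin_subspace)
    show "submodule class_ring (coboundaries G k) (function_space\<lparr>carrier := ?Z\<rparr>)"
      using submodule_coboundaries[of G k] by (simp add: sub Z)
  qed
  then have "betti G k + rk ?W k = vdim ?Z"
    using B by (simp add: betti_def cohomology_def sub Z vdim_def)
  moreover have "rk ?W (Suc k) + vdim ?Z = vdim (alt_cochains ?W (Suc k))"
    unfolding rk_def by (rule vdim_rank_nullity[OF fin_subspace_alt_cochains[OF fin] fun_linear_delta])
  ultimately show ?thesis by (simp add: family_betti_def shift_def)
qed

theorem proposition4:
  fixes G :: "('a, 'b) pre_digraph" and f :: "'a \<Rightarrow> real"
  assumes "graph G" and "morse_function G f"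
  shows "\<exists>r :: real poly. (\<forall>k. 0 \<le> coeff r k) \<and>
    morse_poly G f - poincare_poly G = [:1, 1:] * r"
proof -
  obtain r where r: "\<And>k. 0 \<le> r k" "\<And>k. shift (\<lambda>k. real (num_critical G f k)) k -
      family_betti (whitney_complex G) k = r k + shift r k"
    using family_betti_le_num_critical[OF assms] unfolding morse_le_def by blast
  have ne: "{} \<notin> whitney_complex G" by (simp add: whitney_complex_def)
  \<comment> \<open>there is no empty simplex in the unaugmented complex\<close>
  have r0: "r 0 = 0"
    using r(2)[of 0] by (simp add: shift_def family_betti_def vdim_alt_cochains_0[OF ne] rk_0[OF ne])
  let ?D = "morse_poly G f - poincare_poly G"
  have D: "coeff ?D k = r (Suc k) + r k" for k
    using r(2)[of "Suc k"]
    by (simp add: coeff_morse_poly coeff_poincare_poly assms(1) betti_eq_family_betti shift_def)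
  \<comment> \<open>\<open>r\<close> vanishes beyond the degree because its coefficients are nonnegative and their sums vanish\<close>
  define R where "R = (\<Sum>k\<le>degree ?D. monom (r (Suc k)) k)"
  have R: "coeff R k = r (Suc k)" for k
  proof (cases "k \<le> degree ?D")
    case False
    then have "coeff ?D k = 0" by (intro coeff_eq_0) simp
    then have "r (Suc k) = 0" using D[of k] r(1)[of k] r(1)[of "Suc k"] by linarith
    then show ?thesis using False by (simp add: R_def coeff_sum)
  qed (simp add: R_def coeff_sum)
  show ?thesis
  proof (intro exI conjI allI)
    show "0 \<le> coeff R k" for k using r(1) by (simp add: R)
    show "?D = [:1, 1:] * R"
    proof (rule poly_eqI)
      show "coeff ?D k = coeff ([:1, 1:] * R) k" for k
        by (cases k) (simp_all only: D, simp_all add: R r0 coeff_pCons)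
    qed
  qed
qed

end
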